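(* Let $X$ be a compact metric space, let $Y=\{1,2,\dots,d\}^{\mathbb{N}}$ with shift map $\sigma:Y\to Y$, let $\mu\in P(X)$ be fixed, and let $c:X\times Y\to\mathbb{R}^+$ be a fixed continuous cost function. Let $\Pi(\mu,\sigma)$ be the set of Borel probability measures $\pi$ on $X\times Y$ such that $$\int f(x)\,d\pi(x,y)=\int f(x)\,d\mu(x)\quad\text{for all } f\in C(X),$$ $$\int g(y)\,d\pi(x,y)=\int g(\sigma(y))\,d\pi(x,y)\quad\text{for all } g\in C(Y).$$ Let $\Phi_c$ be the set of pairs $(\varphi,\psi)\in C(X)\times C(Y)$ such that $$\varphi(x)+\psi(y)-(\psi\circ\sigma)(y)\le c(x,y)\qquad\text{for all }(x,y)\in X\times Y.$$ Then: (I) $$\inf_{\pi\in\Pi(\mu,\sigma)}\int c\,d\pi=\sup_{(\varphi,\psi)\in\Phi_c}\int\varphi\,d\mu,$$ and the infimum on the left-hand side is attained. (II) If $c$ is Lipschitz continuous, then there exist Lipschitz continuous functions $\varphi:X\to\mathbb{R}$ and $\psi:Y\to\mathbb{R}$ with $(\varphi,\psi)\in\Phi_c$ that realize the supremum, i.e. $\int\varphi\,d\mu=\sup_{(\tilde\varphi,\tilde\psi)\in\Phi_c}\int\tilde\varphi\,d\mu$.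
   Context: $P(X)$ denotes the set of Borel probability measures on the compact metric space $X$; $C(X)$ denotes the set of continuous real-valued functions on $X$; $\mathbb{R}^+=[0,+\infty)$. The shift on $Y=\{1,\dots,d\}^{\mathbb{N}}$ is $\sigma(y_0,y_1,y_2,\dots)=(y_1,y_2,y_3,\dots)$. The space $Y$ carries the usual metric $d(y,y')=\lambda^{\min\{k:\,y_k\ne y'_k\}}$ for $y\neq y'$ and $d(y,y)=0$, for a fixed $\lambda\in(0,1)$ (for instance $\lambda=1/2$), and $X\times Y$ carries the sum of the two metrics. *)

theory Defs
  imports "HOL-Analysis.Analysis" "HOL-Probability.Probability_Measure"
begin

text \<open>
  Compact metric spaces are represented by compact subsets of a type, so that \<^term>\<open>borel\<close>
  restricted to the set is its Borel sigma-algebra and \<^term>\<open>continuous_on\<close> describes its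
  continuous functions.
\<close>

definition borel_probs :: "'a::topological_space set \<Rightarrow> 'a measure set" where
  "borel_probs X = {M. sets M = sets (restrict_space borel X) \<and> prob_space M}"

subsection \<open>The full shift\<close>

definition full_shift :: "nat \<Rightarrow> (nat \<Rightarrow> nat) set" where
  "full_shift d = {y. \<forall>k. y k \<in> {1..d}}"

definition shift_map :: "(nat \<Rightarrow> 'a) \<Rightarrow> (nat \<Rightarrow> 'a)" where
  "shift_map y = (\<lambda>k. y (Suc k))"

definition seq_dist :: "real \<Rightarrow> (nat \<Rightarrow> 'a) \<Rightarrow> (nat \<Rightarrow> 'a) \<Rightarrow> real" where
  "seq_dist l y y' = (if y = y' then 0 else l ^ (LEAST k. y k \<noteq> y' k))"

text \<open>
  The metric that the type class \<^class>\<open>metric_space\<close> puts on sequences is not \<^term>\<open>seq_dist l\<close>,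
  and in general it is not even Lipschitz equivalent to it; hence the explicit metric below.
  It induces the product topology, see \<open>mtopology_of_shift_metric\<close>.
\<close>

definition shift_metric :: "real \<Rightarrow> nat \<Rightarrow> (nat \<Rightarrow> nat) metric" where
  "shift_metric l d = metric (full_shift d, seq_dist l)"

text \<open>The library's \<^term>\<open>prod_metric\<close> is the Euclidean combination of two metrics, not their sum.\<close>

definition sum_metric :: "'a metric \<Rightarrow> 'b metric \<Rightarrow> ('a \<times> 'b) metric" where
  "sum_metric m1 m2 = metric (mspace m1 \<times> mspace m2,
     \<lambda>z z'. mdist m1 (fst z) (fst z') + mdist m2 (snd z) (snd z'))"

subsection \<open>Invariant plans and admissible pairs\<close>

definition plans ::
  "'a::topological_space set \<Rightarrow> nat \<Rightarrow> 'a measure \<Rightarrow> ('a \<times> (nat \<Rightarrow> nat)) measure set" where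
  "plans X d \<mu> = {\<pi> \<in> borel_probs (X \<times> full_shift d).
     (\<forall>f::'a \<Rightarrow> real. continuous_on X f \<longrightarrow> (\<integral>z. f (fst z) \<partial>\<pi>) = (\<integral>x. f x \<partial>\<mu>)) \<and>
     (\<forall>g::(nat \<Rightarrow> nat) \<Rightarrow> real. continuous_on (full_shift d) g \<longrightarrow>
        (\<integral>z. g (snd z) \<partial>\<pi>) = (\<integral>z. g (shift_map (snd z)) \<partial>\<pi>))}"

definition admissible_pairs ::
  "'a::topological_space set \<Rightarrow> nat \<Rightarrow> ('a \<times> (nat \<Rightarrow> nat) \<Rightarrow> real)
     \<Rightarrow> (('a \<Rightarrow> real) \<times> ((nat \<Rightarrow> nat) \<Rightarrow> real)) set" where
  "admissible_pairs X d c = {(\<phi>, \<psi>). continuous_on X \<phi> \<and> continuous_on (full_shift d) \<psi> \<and>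
     (\<forall>x\<in>X. \<forall>y\<in>full_shift d. \<phi> x + \<psi> y - (\<psi> \<circ> shift_map) y \<le> c (x, y))}"

subsection \<open>The metrics induce the expected topologies\<close>

lemma seq_dist_less_power:
  assumes "0 < l" "l < 1"
  shows "seq_dist l y y' < l ^ n \<longleftrightarrow> (\<forall>k\<le>n. y k = y' k)"
proof (cases "y = y'")
  case False
  define m where "m = (LEAST k. y k \<noteq> y' k)"
  have "\<exists>k. y k \<noteq> y' k" using False by blast
  then have m: "y m \<noteq> y' m" and less: "\<And>k. k < m \<Longrightarrow> y k = y' k"
    unfolding m_def by (rule LeastI_ex, use not_less_Least in blast)
  have "seq_dist l y y' < l ^ n \<longleftrightarrow> n < m"
    using False assms by (simp add: seq_dist_def m_def)
  also have "\<dots> \<longleftrightarrow> (\<forall>k\<le>n. y k = y' k)"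
    using m less by (meson le_less_trans not_less)
  finally show ?thesis .
qed (use assms in \<open>simp add: seq_dist_def\<close>)

lemma seq_dist_triangle:
  assumes "0 < l" "l < 1"
  shows "seq_dist l x z \<le> seq_dist l x y + seq_dist l y z"
proof (rule ccontr)
  assume *: "\<not> ?thesis"
  have nn: "seq_dist l u v \<ge> 0" for u v :: "nat \<Rightarrow> 'a"
    using assms by (simp add: seq_dist_def)
  define n where "n = (LEAST k. x k \<noteq> z k)"
  from * nn[of x y] nn[of y z] have "x \<noteq> z"
    by (auto simp: seq_dist_def)
  then have n: "seq_dist l x z = l ^ n"
    by (simp add: seq_dist_def n_def)
  with * nn[of x y] nn[of y z] have "seq_dist l x y < l ^ n" "seq_dist l y z < l ^ n"
    by auto
  then have "\<forall>k\<le>n. x k = z k"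
    by (simp add: seq_dist_less_power[OF assms])
  then have "seq_dist l x z < l ^ n"
    by (simp add: seq_dist_less_power[OF assms])
  with n show False by simp
qed

lemma Metric_space_seq_dist:
  assumes "0 < l" "l < 1"
  shows "Metric_space S (seq_dist l)"
proof
  show "seq_dist l x y = seq_dist l y x" for x y :: "nat \<Rightarrow> 'a"
  proof (cases "x = y")
    case False
    have "(\<lambda>k. x k \<noteq> y k) = (\<lambda>k. y k \<noteq> x k)" by auto
    with False show ?thesis by (simp add: seq_dist_def)
  qed simp
  show "seq_dist l x z \<le> seq_dist l x y + seq_dist l y z" for x y z :: "nat \<Rightarrow> 'a"
    by (rule seq_dist_triangle[OF assms])
qed (use assms in \<open>auto simp: seq_dist_def\<close>)

lemma mspace_shift_metric [simp]:
  "0 < l \<Longrightarrow> l < 1 \<Longrightarrow> mspace (shift_metric l d) = full_shift d"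
  by (simp add: shift_metric_def Metric_space.mspace_metric Metric_space_seq_dist)

lemma mdist_shift_metric [simp]:
  "0 < l \<Longrightarrow> l < 1 \<Longrightarrow> mdist (shift_metric l d) = seq_dist l"
  by (simp add: shift_metric_def Metric_space.mdist_metric Metric_space_seq_dist)

lemma mtopology_of_shift_metric:
  assumes l: "0 < l" "l < 1"
  shows "mtopology_of (shift_metric l d) = top_of_set (full_shift d)"
proof -
  interpret Metric_space "full_shift d" "seq_dist l"
    by (rule Metric_space_seq_dist[OF l])
  have "openin mtopology U \<longleftrightarrow> openin (top_of_set (full_shift d)) U" for U
  proof
    assume U: "openin mtopology U"
    show "openin (top_of_set (full_shift d)) U"
    proof (subst openin_subopen, intro ballI)
      fix x assume x: "x \<in> U"
      with U obtain r where r: "r > 0" "mball x r \<subseteq> U" and "x \<in> full_shift d"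
        unfolding openin_mtopology by blast
      obtain n where n: "l ^ n < r" using real_arch_pow_inv[OF r(1) l(2)] by blast
      define T where "T = (\<Inter>k\<le>n. {y::nat \<Rightarrow> nat. y k = x k})"
      have "open ((\<lambda>y. y k) -` {x k})" for k
        by (rule open_vimage) (auto intro: open_discrete continuous_on_product_coordinates)
      then have "open {y::nat \<Rightarrow> nat. y k = x k}" for k
        by (simp add: vimage_def)
      then have "open T"
        unfolding T_def by (intro open_INT) auto
      then have "openin (top_of_set (full_shift d)) (full_shift d \<inter> T)"
        by (rule openin_open_Int)
      moreover have "x \<in> full_shift d \<inter> T"
        using \<open>x \<in> full_shift d\<close> by (simp add: T_def)
      moreover have "full_shift d \<inter> T \<subseteq> U"
      proof
        fix y assume y: "y \<in> full_shift d \<inter> T"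
        then have "seq_dist l x y < l ^ n"
          by (auto simp: seq_dist_less_power[OF l] T_def)
        with n y \<open>x \<in> full_shift d\<close> have "y \<in> mball x r" by simp
        with r show "y \<in> U" by blast
      qed
      ultimately show "\<exists>T. openin (top_of_set (full_shift d)) T \<and> x \<in> T \<and> T \<subseteq> U"
        by blast
    qed
  next
    assume "openin (top_of_set (full_shift d)) U"
    then obtain T where T: "open T" "U = full_shift d \<inter> T"
      by (auto simp: openin_open)
    show "openin mtopology U"
      unfolding openin_mtopology
    proof (intro conjI allI impI)
      fix x assume x: "x \<in> U"
      have "openin (product_topology (\<lambda>i::nat. euclidean) UNIV) T" "x \<in> T"
        using T x by (auto simp: open_fun_def)
      from product_topology_open_contains_basis[OF this] obtain V where
        V: "x \<in> (\<Pi>\<^sub>E i\<in>UNIV. V i)" "finite {i. V i \<noteq> UNIV}" "(\<Pi>\<^sub>E i\<in>UNIV. V i) \<subseteq> T"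
        by auto
      obtain n where n: "\<forall>i\<in>{i. V i \<noteq> UNIV}. i \<le> n"
        using V(2) finite_nat_set_iff_bounded_le by blast
      have "mball x (l ^ n) \<subseteq> U"
      proof
        fix y assume y: "y \<in> mball x (l ^ n)"
        then have eq: "\<forall>k\<le>n. x k = y k"
          by (simp add: seq_dist_less_power[OF l])
        have "y i \<in> V i" for i
        proof (cases "V i = UNIV")
          case False
          then have "x i = y i" using n eq by blast
          then show ?thesis using V(1) by (metis PiE_mem UNIV_I)
        qed simp
        then have "y \<in> (\<Pi>\<^sub>E i\<in>UNIV. V i)" by auto
        with V(3) y T show "y \<in> U" by auto
      qed
      then show "\<exists>r>0. mball x r \<subseteq> U"
        using l by (intro exI[of _ "l ^ n"]) simp
    qed (use T in auto)
  qed
  then show ?thesis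
    by (simp add: topology_eq mtopology_of_def l)
qed

lemma Metric_space_sum_metric:
  "Metric_space (mspace m1 \<times> mspace m2)
     (\<lambda>z z'. mdist m1 (fst z) (fst z') + mdist m2 (snd z) (snd z'))"
proof
  show "mdist m1 (fst x) (fst z) + mdist m2 (snd x) (snd z)
      \<le> mdist m1 (fst x) (fst y) + mdist m2 (snd x) (snd y)
        + (mdist m1 (fst y) (fst z) + mdist m2 (snd y) (snd z))"
    if "x \<in> mspace m1 \<times> mspace m2" "y \<in> mspace m1 \<times> mspace m2" "z \<in> mspace m1 \<times> mspace m2"
    for x y z
    using that mdist_triangle[of "fst x" m1 "fst y" "fst z"]
      mdist_triangle[of "snd x" m2 "snd y" "snd z"] by (auto simp: mem_Times_iff)
qed (auto simp: mdist_commute add_nonneg_eq_0_iff)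

lemma mspace_sum_metric [simp]: "mspace (sum_metric m1 m2) = mspace m1 \<times> mspace m2"
  by (simp only: sum_metric_def Metric_space.mspace_metric[OF Metric_space_sum_metric])

lemma mdist_sum_metric [simp]:
  "mdist (sum_metric m1 m2) z z' = mdist m1 (fst z) (fst z') + mdist m2 (snd z) (snd z')"
  by (simp only: sum_metric_def Metric_space.mdist_metric[OF Metric_space_sum_metric])

lemma mtopology_of_sum_metric:
  "mtopology_of (sum_metric m1 m2) = prod_topology (mtopology_of m1) (mtopology_of m2)"
proof -
  interpret S: Metric_space "mspace m1 \<times> mspace m2" "mdist (sum_metric m1 m2)"
    using Metric_space_mspace_mdist[of "sum_metric m1 m2"] by simp
  interpret A: Metric_space "mspace m1" "mdist m1" by simp
  interpret B: Metric_space "mspace m2" "mdist m2" by simp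
  have "openin S.mtopology U \<longleftrightarrow> openin (prod_topology A.mtopology B.mtopology) U" for U
  proof
    assume U: "openin S.mtopology U"
    show "openin (prod_topology A.mtopology B.mtopology) U"
      unfolding openin_prod_topology_alt
    proof (intro allI impI)
      fix x y assume xy: "(x, y) \<in> U"
      with U obtain r where r: "r > 0" "S.mball (x, y) r \<subseteq> U"
        and m: "x \<in> mspace m1" "y \<in> mspace m2"
        unfolding S.openin_mtopology by blast
      have "A.mball x (r/2) \<times> B.mball y (r/2) \<subseteq> S.mball (x, y) r"
        by auto
      with r m show "\<exists>V W. openin A.mtopology V \<and> openin B.mtopology W \<and> x \<in> V \<and> y \<in> W \<and> V \<times> W \<subseteq> U"
        by (intro exI[of _ "A.mball x (r/2)"] exI[of _ "B.mball y (r/2)"]) auto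
    qed
  next
    assume U: "openin (prod_topology A.mtopology B.mtopology) U"
    show "openin S.mtopology U"
      unfolding S.openin_mtopology
    proof (intro conjI allI impI)
      show "U \<subseteq> mspace m1 \<times> mspace m2"
        using openin_subset[OF U] by simp
      fix z assume "z \<in> U"
      then obtain x y where z: "z = (x, y)" "(x, y) \<in> U" by (cases z) auto
      then obtain V W where VW: "openin A.mtopology V" "openin B.mtopology W"
        "x \<in> V" "y \<in> W" "V \<times> W \<subseteq> U"
        using openin_prod_topology_alt[THEN iffD1, OF U] by meson
      obtain r where r: "r > 0" "A.mball x r \<subseteq> V"
        using VW unfolding A.openin_mtopology by blast
      obtain s where s: "s > 0" "B.mball y s \<subseteq> W"
        using VW unfolding B.openin_mtopology by blast
      have "S.mball z (min r s) \<subseteq> A.mball x r \<times> B.mball y s"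
      proof
        fix w assume "w \<in> S.mball z (min r s)"
        then have w: "x \<in> mspace m1" "y \<in> mspace m2" "fst w \<in> mspace m1" "snd w \<in> mspace m2"
          "mdist m1 x (fst w) + mdist m2 y (snd w) < min r s"
          by (auto simp: z(1))
        with mdist_nonneg[of m1 x "fst w"] mdist_nonneg[of m2 y "snd w"]
        have "mdist m1 x (fst w) < r" "mdist m2 y (snd w) < s" by linarith+
        with w show "w \<in> A.mball x r \<times> B.mball y s" by (simp add: mem_Times_iff)
      qed
      with r s VW(5) show "\<exists>r>0. S.mball z r \<subseteq> U"
        by (intro exI[of _ "min r s"]) auto
    qed
  qed
  then show ?thesis
    by (simp add: topology_eq mtopology_of_def)
qed

lemma mtopology_of_sum_shift_metric:
  assumes "0 < l" "l < 1"
  shows "mtopology_of (sum_metric (submetric euclidean_metric X) (shift_metric l d))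
    = top_of_set (X \<times> full_shift d)"
  by (simp add: mtopology_of_sum_metric mtopology_of_shift_metric[OF assms] mtopology_of_submetric
      subtopology_Times[symmetric])

end

theory Submission
  imports Defs
begin

text \<open>
  For part (I), put \<open>p h = Inf (\<integral> \<phi> d\<mu> + t v)\<close> over all \<open>\<phi>\<close>, \<open>\<psi>\<close> and \<open>t \<ge> 0\<close> with
  \<open>h \<le> \<phi> + \<psi> - \<psi> \<circ> \<sigma> + t c\<close>, where \<open>v\<close> is the value of the dual problem. This is sublinear and finite
  (\<open>\<sigma>\<close> has a fixed point), and a linear functional below \<open>p\<close>, which exists by Hahn-Banach, is
  integration against an optimal plan by the Riesz representation theorem.

  For part (II), an admissible pair can be improved to one with Lipschitz constants that depend only on
  \<open>c\<close> and the metric: replace \<open>\<psi>\<close> by a potential defined by a supremum over backward orbits of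
  the shift, whose inverse branches contract, and then \<open>\<phi>\<close> by the largest function admissible with
  it. Compactness gives a limit \<open>\<phi>\<close> of a maximizing sequence; the existence of a potential for
  \<open>\<phi>\<close> amounts to a uniform bound on finite sums along orbits, which survives pointwise limits.
\<close>

subsection \<open>Dominated linear functionals\<close>

text \<open>The weight \<open>v\<close> of \<open>t\<close> is why one extension step suffices:
  charging \<open>v\<close> for \<open>c\<close> forces the functional to be at most
  \<open>v\<close> at \<open>c\<close>, so marginal, invariance, positivity and optimality come out
  together, without a compactness argument on the set of plans. In return \<open>p\<close> must be
  kept from collapsing to minus infinity. For \<open>t > 0\<close> this is the definition of
  \<open>v\<close> after division by \<open>t\<close>; for \<open>t = 0\<close> it is evaluation at
  the fixed point, where coboundaries vanish. In part (II) the obstacle is that the functions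
  \<open>\<psi>\<close> of a maximizing sequence need not share a modulus of continuity. Hence the
  existence of \<open>\<psi>\<close> is recast as a condition on \<open>\<phi>\<close> alone, only
  \<open>\<phi>\<close> is taken to the limit, and \<open>\<psi>\<close> is rebuilt afterwards. If
  \<open>L\<close> is a Lipschitz constant of \<open>c\<close> and \<open>l\<close> the ratio of the
  shift metric, the constants are \<open>L\<close> for \<open>\<phi>\<close> and
  \<open>L / (1 - l)\<close> for \<open>\<psi>\<close>: a change of the end point is felt
  \<open>k\<close> steps earlier with factor \<open>l ^ k\<close>.\<close>

definition function_subspace :: "('z \<Rightarrow> real) set \<Rightarrow> bool" where
  "function_subspace S \<longleftrightarrow> (\<lambda>z. 0) \<in> S \<and> (\<forall>f\<in>S. \<forall>g\<in>S. (\<lambda>z. f z + g z) \<in> S)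
     \<and> (\<forall>a. \<forall>f\<in>S. (\<lambda>z. a * f z) \<in> S)"

definition sublinear_on :: "('z \<Rightarrow> real) set \<Rightarrow> (('z \<Rightarrow> real) \<Rightarrow> real) \<Rightarrow> bool" where
  "sublinear_on S q \<longleftrightarrow> (\<forall>f\<in>S. \<forall>g\<in>S. q (\<lambda>z. f z + g z) \<le> q f + q g)
     \<and> (\<forall>f\<in>S. \<forall>a\<ge>0. q (\<lambda>z. a * f z) = a * q f)"

definition linear_functional_on :: "('z \<Rightarrow> real) set \<Rightarrow> (('z \<Rightarrow> real) \<Rightarrow> real) \<Rightarrow> bool" where
  "linear_functional_on S L \<longleftrightarrow> (\<forall>f\<in>S. \<forall>g\<in>S. L (\<lambda>z. f z + g z) = L f + L g)
     \<and> (\<forall>f\<in>S. \<forall>a. L (\<lambda>z. a * f z) = a * L f)"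

lemma function_subspaceD:
  assumes "function_subspace S"
  shows "(\<lambda>z. 0) \<in> S" "f \<in> S \<Longrightarrow> g \<in> S \<Longrightarrow> (\<lambda>z. f z + g z) \<in> S" "f \<in> S \<Longrightarrow> (\<lambda>z. a * f z) \<in> S"
  using assms by (auto simp: function_subspace_def)

lemma sublinear_onD:
  assumes "sublinear_on S q"
  shows "f \<in> S \<Longrightarrow> g \<in> S \<Longrightarrow> q (\<lambda>z. f z + g z) \<le> q f + q g"
    "f \<in> S \<Longrightarrow> 0 \<le> a \<Longrightarrow> q (\<lambda>z. a * f z) = a * q f"
  using assms by (auto simp: sublinear_on_def)

lemma linear_functional_onD:
  assumes "linear_functional_on S L"
  shows "f \<in> S \<Longrightarrow> g \<in> S \<Longrightarrow> L (\<lambda>z. f z + g z) = L f + L g"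
    "f \<in> S \<Longrightarrow> L (\<lambda>z. a * f z) = a * L f"
  using assms by (auto simp: linear_functional_on_def)

text \<open>For \<open>a > 0\<close> one inequality suffices: applied to \<open>a f\<close> with the
  factor \<open>1 / a\<close> it yields the reverse one.\<close>

lemma sublinear_onI:
  assumes S: "function_subspace S"
    and add: "\<And>f g. f \<in> S \<Longrightarrow> g \<in> S \<Longrightarrow> q (\<lambda>z. f z + g z) \<le> q f + q g"
    and scale: "\<And>f a. f \<in> S \<Longrightarrow> 0 < a \<Longrightarrow> q (\<lambda>z. a * f z) \<le> a * q f"
    and zero: "q (\<lambda>z. 0) = 0"
  shows "sublinear_on S q"
  unfolding sublinear_on_def
proof (intro conjI ballI allI impI)
  fix f a assume f: "f \<in> S" and a: "(0::real) \<le> a"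
  show "q (\<lambda>z. a * f z) = a * q f"
  proof (cases "a = 0")
    case False
    with a have a: "0 < a" by simp
    have "q (\<lambda>z. (1/a) * (a * f z)) \<le> (1/a) * q (\<lambda>z. a * f z)"
      using function_subspaceD(3)[OF S f] a by (intro scale) auto
    then have "a * q f \<le> q (\<lambda>z. a * f z)"
      using a by (simp add: field_simps)
    with scale[OF f a] show ?thesis by simp
  qed (simp add: zero)
qed (use add in auto)

text \<open>From \<open>0 = q (f - f) \<le> q f + q (- f)\<close>. This lower bound keeps the infima
  along chains in Zorn's lemma finite.\<close>

lemma sublinear_on_lower:
  assumes S: "function_subspace S" and q: "sublinear_on S q" and f: "f \<in> S"
  shows "- q (\<lambda>z. - f z) \<le> q f"
proof -
  have m: "(\<lambda>z. - f z) \<in> S"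
    using function_subspaceD(3)[OF S f, of "-1"] by simp
  have "q (\<lambda>z. 0) = 0"
    using sublinear_onD(2)[OF q f, of 0] by simp
  with sublinear_onD(1)[OF q f m] show ?thesis by simp
qed

text \<open>By Zorn's lemma there is a minimal sublinear functional below \<open>p\<close>; minimality forces it to be
  linear, because \<open>f \<mapsto> INF t\<ge>0. m (f + t g) - t m g\<close> is again sublinear and below \<open>m\<close>.\<close>

lemma minimal_sublinear_additive:
  assumes S: "function_subspace S" and m: "sublinear_on S m"
    and minimal: "\<And>q. sublinear_on S q \<Longrightarrow> (\<forall>f\<in>S. q f \<le> m f) \<Longrightarrow> (\<forall>f\<in>S. q f = m f)"
    and f: "f \<in> S" and g: "g \<in> S"
  shows "m (\<lambda>z. f z + g z) = m f + m g"
proof -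
  note S' = function_subspaceD[OF S] and m' = sublinear_onD[OF m]
  define b where "b f t = m (\<lambda>z. f z + t * g z) - t * m g" for f t
  define q where "q f = (INF t\<in>{0..}. b f t)" for f
  have low: "- m (\<lambda>z. - f z) \<le> b f t" if "f \<in> S" "0 \<le> t" for f t
  proof -
    have neg: "(\<lambda>z. - f z) \<in> S" using S'(3)[OF that(1), of "-1"] by simp
    have "m (\<lambda>z. (f z + t * g z) + - f z) \<le> m (\<lambda>z. f z + t * g z) + m (\<lambda>z. - f z)"
      by (intro m' S' neg that g)
    moreover have "m (\<lambda>z. t * g z) = t * m g" by (rule m'(2)[OF g that(2)])
    ultimately show ?thesis by (simp add: b_def)
  qed
  then have bdd: "bdd_below (b f ` {0..})" if "f \<in> S" for f
    using that by (intro bdd_belowI2[where m = "- m (\<lambda>z. - f z)"]) auto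
  have q_le: "q f \<le> b f t" if "f \<in> S" "0 \<le> t" for f t
    unfolding q_def using that by (intro cINF_lower bdd) auto
  have q_ge: "x \<le> q f" if "\<And>t. 0 \<le> t \<Longrightarrow> x \<le> b f t" for f x
    unfolding q_def using that by (intro cINF_greatest) auto
  have "sublinear_on S q"
  proof (rule sublinear_onI[OF S])
    fix f h assume fh: "f \<in> S" "h \<in> S"
    have "q (\<lambda>z. f z + h z) \<le> b f s + b h t" if st: "0 \<le> s" "0 \<le> t" for s t
    proof -
      have "q (\<lambda>z. f z + h z) \<le> b (\<lambda>z. f z + h z) (s + t)"
        using st by (intro q_le S' fh) auto
      also have "(\<lambda>z. f z + h z + (s + t) * g z) = (\<lambda>z. (f z + s * g z) + (h z + t * g z))"
        by (auto simp: algebra_simps)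
      then have "b (\<lambda>z. f z + h z) (s + t) \<le> b f s + b h t"
        using m'(1)[OF S'(2)[OF fh(1) S'(3)[OF g, of s]] S'(2)[OF fh(2) S'(3)[OF g, of t]]]
        by (simp add: b_def algebra_simps)
      finally show ?thesis .
    qed
    then have "q (\<lambda>z. f z + h z) - b f s \<le> q h" if "0 \<le> s" for s
      using that by (intro q_ge) (simp add: algebra_simps)
    then have "q (\<lambda>z. f z + h z) - q h \<le> q f"
      by (intro q_ge) (simp add: algebra_simps)
    then show "q (\<lambda>z. f z + h z) \<le> q f + q h" by simp
  next
    fix f a assume f: "f \<in> S" and a: "(0::real) < a"
    have "q (\<lambda>z. a * f z) / a \<le> b f t" if t: "0 \<le> t" for t
    proof -
      have "q (\<lambda>z. a * f z) \<le> b (\<lambda>z. a * f z) (a * t)"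
        using a t by (intro q_le S' f) auto
      also have "(\<lambda>z. a * f z + a * t * g z) = (\<lambda>z. a * (f z + t * g z))"
        by (auto simp: algebra_simps)
      then have "b (\<lambda>z. a * f z) (a * t) = a * b f t"
        using m'(2)[OF S'(2)[OF f S'(3)[OF g, of t]], of a] a by (simp add: b_def algebra_simps)
      finally show ?thesis using a by (simp add: field_simps)
    qed
    then have "q (\<lambda>z. a * f z) / a \<le> q f" by (rule q_ge)
    then show "q (\<lambda>z. a * f z) \<le> a * q f" using a by (simp add: field_simps)
  next
    have "b (\<lambda>z. 0) t = 0" if "0 \<le> t" for t
      using m'(2)[OF g that] by (simp add: b_def)
    then show "q (\<lambda>z. 0) = 0" by (simp add: q_def)
  qed
  moreover have "q h \<le> m h" if "h \<in> S" for h
    using q_le[OF that, of 0] by (simp add: b_def)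
  \<comment> \<open>Minimality turns \<open>q \<le> m\<close> into equality; comparing the infimum
    with its value at \<open>t = 1\<close> then gives superadditivity of \<open>m\<close>.\<close>
  ultimately have "q f = m f" using minimal f by blast
  with q_le[OF f, of 1] have "m f + m g \<le> m (\<lambda>z. f z + g z)" by (simp add: b_def)
  with m'(1)[OF f g] show ?thesis by simp
qed

lemma sublinear_on_cong:
  assumes "function_subspace S" "sublinear_on S q" "\<And>f. f \<in> S \<Longrightarrow> q' f = q f"
  shows "sublinear_on S q'"
  using assms by (simp add: sublinear_on_def function_subspace_def)

text \<open>Zorn's lemma runs over sublinear functionals on all of \<open>S\<close>, instead of over
  linear functionals on growing subspaces, so there is no one-dimensional extension step.\<close>

lemma hahn_banach_dominated:
  assumes S: "function_subspace S" and p: "sublinear_on S p"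
  obtains L where "linear_functional_on S L" "\<And>f. f \<in> S \<Longrightarrow> L f \<le> p f"
proof -
  note S' = function_subspaceD[OF S]
  have neg: "(\<lambda>z. - f z) \<in> S" if "f \<in> S" for f
    using S'(3)[OF that, of "-1"] by simp
  \<comment> \<open>Values outside \<open>S\<close> are pinned to 0, because the order
    \<open>P\<close> compares functionals at all functions and a chain could be unbounded below
    there. In \<open>P q q'\<close> the smaller functional is \<open>q'\<close>, so Zorn's maximal
    element is a minimal functional.\<close>
  define Q where "Q = {q. sublinear_on S q \<and> (\<forall>f\<in>S. q f \<le> p f) \<and> (\<forall>f. f \<notin> S \<longrightarrow> q f = 0)}"
  define P where "P q q' \<longleftrightarrow> (\<forall>f. q' f \<le> q f)" for q q' :: "('a \<Rightarrow> real) \<Rightarrow> real"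
  have low: "- p (\<lambda>z. - f z) \<le> q f" if "q \<in> Q" "f \<in> S" for q f
    using sublinear_on_lower[OF S _ that(2), of q] that neg[OF that(2)] unfolding Q_def by force
  have "\<exists>m\<in>Q. \<forall>q\<in>Q. P m q \<longrightarrow> q = m"
  proof (rule predicate_Zorn)
    show "partial_order_on Q (relation_of P Q)"
    proof (rule partial_order_on_relation_ofI)
      show "q = q'" if "P q q'" "P q' q" for q q'
        using that by (intro ext antisym) (auto simp: P_def)
    qed (auto simp: P_def intro: order_trans)
    fix C assume C: "C \<in> Chains (relation_of P Q)"
    then have CQ: "C \<subseteq> Q" and chain: "\<And>q q'. q \<in> C \<Longrightarrow> q' \<in> C \<Longrightarrow> P q q' \<or> P q' q"
      by (auto simp: Chains_def relation_of_def)
    show "\<exists>u\<in>Q. \<forall>q\<in>C. P q u"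
    proof (cases "C = {}")
      case True
      have "(\<lambda>f. if f \<in> S then p f else 0) \<in> Q"
        using sublinear_on_cong[OF S p] by (simp add: Q_def)
      with True show ?thesis by blast
    next
      case False
      define u where "u f = (if f \<in> S then INF q\<in>C. q f else 0)" for f
      have bdd: "bdd_below ((\<lambda>q. q f) ` C)" if "f \<in> S" for f
        using low CQ that by (intro bdd_belowI2[where m = "- p (\<lambda>z. - f z)"]) auto
      have u_le: "u f \<le> q f" if "f \<in> S" "q \<in> C" for q f
        using that bdd by (auto simp: u_def intro!: cINF_lower)
      have u_ge: "x \<le> u f" if "\<And>q. q \<in> C \<Longrightarrow> x \<le> q f" "f \<in> S" for f x
        using that False by (auto simp: u_def intro!: cINF_greatest)
      have sub: "sublinear_on S q" if "q \<in> C" for q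
        using that CQ by (auto simp: Q_def)
      have "sublinear_on S u"
      proof (rule sublinear_onI[OF S])
        fix f g assume fg: "f \<in> S" "g \<in> S"
        have bound: "u (\<lambda>z. f z + g z) \<le> q f + q' g" if q: "q \<in> C" "q' \<in> C" for q q'
        proof -
          \<comment> \<open>Subadditivity of the infimum rests on the chain property: the smaller of
            \<open>q\<close> and \<open>q'\<close> serves for both summands.\<close>
          obtain r where r: "r \<in> C" "r f \<le> q f" "r g \<le> q' g"
            using chain[OF q] q by (auto simp: P_def)
          have "u (\<lambda>z. f z + g z) \<le> r (\<lambda>z. f z + g z)"
            by (intro u_le S' fg r)
          also have "\<dots> \<le> r f + r g"
            by (intro sublinear_onD(1)[OF sub] r fg)
          finally show ?thesis using r by linarith
        qed
        have "u (\<lambda>z. f z + g z) - q f \<le> u g" if "q \<in> C" for q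
        proof (rule u_ge[OF _ fg(2)])
          show "u (\<lambda>z. f z + g z) - q f \<le> q' g" if "q' \<in> C" for q'
            using bound[OF \<open>q \<in> C\<close> that] by linarith
        qed
        then have "u (\<lambda>z. f z + g z) - u g \<le> u f"
          using fg by (intro u_ge) (simp_all add: algebra_simps)
        then show "u (\<lambda>z. f z + g z) \<le> u f + u g" by simp
      next
        fix f a assume f: "f \<in> S" and a: "(0::real) < a"
        have "u (\<lambda>z. a * f z) / a \<le> q f" if q: "q \<in> C" for q
          using u_le[OF S'(3)[OF f, of a] q] sublinear_onD(2)[OF sub[OF q] f, of a] a
          by (simp add: field_simps)
        then have "u (\<lambda>z. a * f z) / a \<le> u f" using f by (rule u_ge)
        then show "u (\<lambda>z. a * f z) \<le> a * u f" using a by (simp add: field_simps)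
      next
        have "q (\<lambda>z. 0) = 0" if "q \<in> C" for q
          using sublinear_onD(2)[OF sub[OF that] S'(1), of 0] by simp
        then have "(\<lambda>q. q (\<lambda>z. 0)) ` C = {0}" using False by force
        then show "u (\<lambda>z. 0) = 0" using S'(1) by (simp add: u_def)
      qed
      moreover obtain q0 where q0: "q0 \<in> C" using False by blast
      then have "u f \<le> p f" if "f \<in> S" for f
        using u_le[OF that q0] that CQ by (force simp: Q_def)
      ultimately have "u \<in> Q" by (auto simp: Q_def u_def)
      moreover have "P q u" if "q \<in> C" for q
        using u_le that CQ by (auto simp: P_def u_def Q_def)
      ultimately show ?thesis by blast
    qed
  qed
  then obtain m where m: "m \<in> Q" "\<And>q. q \<in> Q \<Longrightarrow> P m q \<Longrightarrow> q = m" by blast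
  have sub: "sublinear_on S m" using m(1) by (simp add: Q_def)
  have minimal: "\<forall>f\<in>S. q f = m f" if q: "sublinear_on S q" "\<forall>f\<in>S. q f \<le> m f" for q
  proof -
    define q' where "q' f = (if f \<in> S then q f else 0)" for f
    have "sublinear_on S q'" using sublinear_on_cong[OF S q(1)] by (simp add: q'_def)
    then have "q' \<in> Q" "P m q'"
      using q m(1) by (force simp: Q_def P_def q'_def)+
    with m(2) have "q' = m" by blast
    then have "q' f = m f" for f by simp
    then show ?thesis unfolding q'_def by metis
  qed
  have add: "m (\<lambda>z. f z + g z) = m f + m g" if "f \<in> S" "g \<in> S" for f g
    by (rule minimal_sublinear_additive[OF S sub minimal that])
  have m_neg: "m (\<lambda>z. - f z) = - m f" if "f \<in> S" for f
    using add[OF that neg[OF that]] sublinear_onD(2)[OF sub that, of 0] by simp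
  have "m (\<lambda>z. a * f z) = a * m f" if f: "f \<in> S" for a f
  proof (cases "0 \<le> a")
    case False
    then have "m (\<lambda>z. (- a) * - f z) = (- a) * m (\<lambda>z. - f z)"
      by (intro sublinear_onD(2)[OF sub neg[OF f]]) simp
    then show ?thesis by (simp add: m_neg[OF f])
  qed (rule sublinear_onD(2)[OF sub f])
  then have "linear_functional_on S m"
    using add by (simp add: linear_functional_on_def)
  moreover have "m f \<le> p f" if "f \<in> S" for f
    using m(1) that by (simp add: Q_def)
  ultimately show thesis using that by blast
qed

subsection \<open>Riesz representation on compact sets\<close>

lemma function_subspace_continuous_on: "function_subspace {h. continuous_on K h}"
  by (auto simp: function_subspace_def intro!: continuous_intros)

lemma space_borel_probs: "M \<in> borel_probs K \<Longrightarrow> space M = K"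
  using sets_eq_imp_space_eq[of M "restrict_space borel K"]
  by (auto simp: borel_probs_def space_restrict_space)

lemma borel_measurable_continuous_on_borel_probs:
  fixes g :: "'a::topological_space \<Rightarrow> real"
  assumes "M \<in> borel_probs K" "continuous_on K g"
  shows "g \<in> borel_measurable M"
  using borel_measurable_continuous_on_restrict[OF assms(2)] assms(1)
  by (simp add: borel_probs_def cong: measurable_cong_sets)

lemma integrable_continuous_on_compact:
  fixes g :: "'a::topological_space \<Rightarrow> real"
  assumes M: "M \<in> borel_probs K" and K: "compact K" and g: "continuous_on K g"
  shows "integrable M g"
proof -
  interpret prob_space M using M by (simp add: borel_probs_def)
  obtain B where "\<forall>z\<in>K. norm (g z) \<le> B"
    using compact_imp_bounded[OF compact_continuous_image[OF g K]] by (auto simp: bounded_iff)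
  then show ?thesis
    by (intro integrable_const_bound[where B = B] AE_I2
        borel_measurable_continuous_on_borel_probs[OF M g]) (simp add: space_borel_probs[OF M])
qed

text \<open>The witness is the distance to \<open>K - U\<close> in \<open>m\<close>, so any metric
  inducing the right topology will do.\<close>

lemma open_cozero_of_metric:
  fixes K :: "'z::topological_space set"
  assumes m: "mtopology_of m = top_of_set K" and U: "open U"
  shows "\<exists>g::'z \<Rightarrow> real. continuous_on K g \<and> (\<forall>z\<in>K. 0 \<le> g z) \<and> K \<inter> U = {z\<in>K. 0 < g z}"
proof (cases "K \<subseteq> U")
  \<comment> \<open>Here \<open>K - U\<close> is empty and the infimum of distances would be
    meaningless.\<close>
  case True
  then show ?thesis by (intro exI[of _ "\<lambda>z. 1"]) auto
next
  case False
  have space: "mspace m = K"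
    using arg_cong[OF m, of topspace] by simp
  define g where "g z = (INF w\<in>K - U. mdist m z w)" for z
  have g_le: "g z \<le> mdist m z w" if "w \<in> K - U" for z w
    unfolding g_def using that by (intro cINF_lower bdd_belowI2[where m = 0]) auto
  have g_ge: "a \<le> g z" if "\<And>w. w \<in> K - U \<Longrightarrow> a \<le> mdist m z w" for a z
    unfolding g_def using that False by (intro cINF_greatest) auto
  have lip: "g z - mdist m z z' \<le> g z'" if "z \<in> K" "z' \<in> K" for z z'
  proof (rule g_ge)
    show "g z - mdist m z z' \<le> mdist m z' w" if w: "w \<in> K - U" for w
      using g_le[OF w, of z] mdist_triangle[of z m z' w] \<open>z \<in> K\<close> \<open>z' \<in> K\<close> w by (simp add: space)
  qed
  have "Lipschitz_continuous_map m euclidean_metric g"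
    unfolding Lipschitz_continuous_map_def
  proof (intro conjI exI[of _ 1] ballI)
    show "mdist euclidean_metric (g z) (g z') \<le> 1 * mdist m z z'"
      if "z \<in> mspace m" "z' \<in> mspace m" for z z'
      using lip[of z z'] lip[of z' z] that mdist_commute[of m z z']
      by (simp add: space dist_real_def abs_le_iff)
  qed auto
  then have "continuous_on K g"
    using Lipschitz_continuous_imp_continuous_map[of m euclidean_metric g]
    by (simp add: m continuous_map_iff_continuous)
  moreover have "0 \<le> g z" for z by (rule g_ge) simp
  moreover have "0 < g z" if z: "z \<in> K \<inter> U" for z
  proof -
    interpret Metric_space "mspace m" "mdist m" by simp
    have "openin mtopology (K \<inter> U)"
      using openin_open_Int[OF U, of K] m by (simp add: mtopology_of_def)
    then obtain r where r: "0 < r" "mball z r \<subseteq> K \<inter> U"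
      using z unfolding openin_mtopology by blast
    have "r \<le> g z"
    proof (rule g_ge)
      show "r \<le> mdist m z w" if w: "w \<in> K - U" for w
      proof (rule ccontr)
        assume "\<not> r \<le> mdist m z w"
        moreover have "w \<in> mspace m" "z \<in> mspace m" using w z by (auto simp: space)
        ultimately have "w \<in> mball z r" by simp
        with r(2) w show False by blast
      qed
    qed
    with r(1) show ?thesis by simp
  qed
  moreover have "\<not> 0 < g z" if "z \<in> K" "z \<notin> U" for z
  proof -
    have "mdist m z z = 0" using that(1) by (simp add: space)
    with g_le[of z z] that show ?thesis by simp
  qed
  ultimately show ?thesis by (intro exI[of _ g]) blast
qed

text \<open>The assumption \<open>cozero\<close> ties the functional to the Borel sets: the sets
  \<open>{g > 0}\<close> with \<open>g\<close> continuous generate them, so Caratheodory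
  measurability has to be checked for these only.\<close>

locale positive_functional =
  fixes K :: "'z::topological_space set" and L :: "('z \<Rightarrow> real) \<Rightarrow> real"
  assumes compact_K: "compact K"
    and cozero: "\<And>U. open U \<Longrightarrow>
      \<exists>g::'z \<Rightarrow> real. continuous_on K g \<and> (\<forall>z\<in>K. 0 \<le> g z) \<and> K \<inter> U = {z\<in>K. 0 < g z}"
    and linear: "linear_functional_on {h. continuous_on K h} L"
    and nonneg: "\<And>h. continuous_on K h \<Longrightarrow> (\<And>z. z \<in> K \<Longrightarrow> 0 \<le> h z) \<Longrightarrow> 0 \<le> L h"
    and one: "L (\<lambda>z. 1) = 1"
begin

lemma L_add: "continuous_on K f \<Longrightarrow> continuous_on K g \<Longrightarrow> L (\<lambda>z. f z + g z) = L f + L g"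
  by (simp add: linear_functional_onD[OF linear])

lemma L_scale: "continuous_on K f \<Longrightarrow> L (\<lambda>z. a * f z) = a * L f"
  by (simp add: linear_functional_onD[OF linear])

lemma L_diff:
  assumes "continuous_on K f" "continuous_on K g"
  shows "L (\<lambda>z. f z - g z) = L f - L g"
  using L_add[of f "\<lambda>z. -1 * g z"] L_scale[of g "-1"] assms by (simp add: continuous_intros)

lemma L_zero: "L (\<lambda>z. 0) = 0"
  using L_scale[of "\<lambda>z. 0" 0] by simp

lemma L_const: "L (\<lambda>z. a) = a"
  using L_scale[of "\<lambda>z. 1" a] one by simp

lemma L_mono:
  assumes "continuous_on K f" "continuous_on K g" "\<And>z. z \<in> K \<Longrightarrow> f z \<le> g z"
  shows "L f \<le> L g"
  using nonneg[of "\<lambda>z. g z - f z"] assms by (simp add: L_diff continuous_intros)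

lemma L_sum:
  assumes "\<And>i. i \<in> I \<Longrightarrow> continuous_on K (f i)"
  shows "L (\<lambda>z. \<Sum>i\<in>I. f i z) = (\<Sum>i\<in>I. L (f i))"
proof (cases "finite I")
  case True
  then show ?thesis using assms
    by (induction I) (simp_all add: L_zero L_add continuous_on_sum)
qed (simp add: L_zero)

section \<open>The outer measure of a positive functional\<close>

definition covers :: "'z set \<Rightarrow> (nat \<Rightarrow> 'z \<Rightarrow> real) \<Rightarrow> bool" where
  "covers E f \<longleftrightarrow> (\<forall>n. continuous_on K (f n) \<and> (\<forall>z\<in>K. 0 \<le> f n z))
     \<and> (\<forall>z\<in>E. 1 \<le> (\<Sum>n. ennreal (f n z)))"

text \<open>A Daniell upper integral of the indicator of \<open>E\<close>: covers are series of
  nonnegative continuous functions instead of open sets, so that countable subadditivity becomes a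
  rearrangement of double series.\<close>

definition outer :: "'z set \<Rightarrow> ennreal" where
  "outer E = (INF f\<in>Collect (covers E). \<Sum>n. ennreal (L (f n)))"

lemma coversD:
  assumes "covers E f"
  shows "continuous_on K (f n)" "z \<in> K \<Longrightarrow> 0 \<le> f n z" "z \<in> E \<Longrightarrow> 1 \<le> (\<Sum>n. ennreal (f n z))"
    "0 \<le> L (f n)"
  using assms by (auto simp: covers_def intro!: nonneg)

lemma outer_le: "covers E f \<Longrightarrow> outer E \<le> (\<Sum>n. ennreal (L (f n)))"
  by (auto simp: outer_def intro!: INF_lower)

lemma outer_le_single:
  assumes "continuous_on K h" "\<And>z. z \<in> K \<Longrightarrow> 0 \<le> h z" "\<And>z. z \<in> E \<Longrightarrow> 1 \<le> h z"
  shows "outer E \<le> ennreal (L h)"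
proof -
  define f where "f n = (if n = 0 then h else (\<lambda>z. 0))" for n :: nat
  have s: "(\<Sum>n. F (f n)) = F h" if "F (\<lambda>z. 0) = 0" for F :: "_ \<Rightarrow> ennreal"
    using suminf_finite[of "{0}" "\<lambda>n. F (f n)"] that by (simp add: f_def)
  have "covers E f"
    using assms s[of "\<lambda>h. ennreal (h z)" for z] by (auto simp: covers_def f_def)
  from outer_le[OF this] show ?thesis
    using s[of "\<lambda>h. ennreal (L h)"] by (simp add: L_zero)
qed

lemma outer_le_one: "outer E \<le> 1"
  using outer_le_single[of "\<lambda>z. 1" E] by (simp add: one)

lemma outer_empty: "outer {} = 0"
  using outer_le_single[of "\<lambda>z. 0" "{}"] by (simp add: L_zero)

lemma outer_mono: "E \<subseteq> F \<Longrightarrow> outer E \<le> outer F"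
  unfolding outer_def by (rule INF_superset_mono) (auto simp: covers_def subset_eq)

text \<open>Dini's argument: by compactness finitely many terms of the series already exceed \<open>1 - e\<close>.\<close>

lemma outer_space: "outer K = 1"
proof (rule antisym[OF outer_le_one])
  have "1 \<le> (\<Sum>n. ennreal (L (f n)))" if f: "covers K f" for f
  proof (rule ennreal_le_epsilon)
    fix e :: real assume e: "0 < e"
    define U where "U N = {z\<in>K. 1 - e < (\<Sum>n<N. f n z)}" for N
    have cont: "continuous_on K (\<lambda>z. \<Sum>n<N. f n z)" for N
      by (intro continuous_on_sum coversD(1)[OF f])
    have "openin (top_of_set K) (U N)" for N
    proof -
      have "U N = K \<inter> (\<lambda>z. \<Sum>n<N. f n z) -` {1 - e<..}"
        by (auto simp only: U_def)
      then show ?thesis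
        using continuous_openin_preimage_gen[OF cont, of "{1 - e<..}" N] by (simp only: open_greaterThan)
    qed
    moreover have "K \<subseteq> (\<Union>N. U N)"
    proof
      fix z assume z: "z \<in> K"
      have "ennreal (1 - e) < 1" using e by (simp add: ennreal_less_one_iff)
      also have "1 \<le> (\<Sum>n. ennreal (f n z))" by (rule coversD(3)[OF f z])
      also have "\<dots> = (SUP N. \<Sum>n<N. ennreal (f n z))" by (rule suminf_eq_SUP)
      finally obtain N where "ennreal (1 - e) < (\<Sum>n<N. ennreal (f n z))"
        by (auto simp: less_SUP_iff)
      also have "\<dots> = ennreal (\<Sum>n<N. f n z)"
        by (intro sum_ennreal coversD(2)[OF f z])
      finally have "1 - e < (\<Sum>n<N. f n z)"
        using ennreal_leI[of "\<Sum>n<N. f n z" "1 - e"] by (meson leD leI)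
      with z show "z \<in> (\<Union>N. U N)" by (auto simp: U_def)
    qed
    ultimately obtain D where D: "D \<subseteq> range U" "finite D" "K \<subseteq> \<Union>D"
      using compact_K[unfolded compact_eq_openin_cover, rule_format, of "range U"] by blast
    then obtain I where I: "finite I" "D = U ` I"
      using finite_subset_image[OF D(2,1)] by metis
    obtain N where N: "\<And>i. i \<in> I \<Longrightarrow> i \<le> N"
      using I(1)[unfolded finite_nat_set_iff_bounded_le] by metis
    \<comment> \<open>The sets \<open>U N\<close> grow with \<open>N\<close> because the terms are
      nonnegative, so one index serves all of \<open>K\<close>.\<close>
    have "1 - e \<le> (\<Sum>n<N. f n z)" if z: "z \<in> K" for z
    proof -
      obtain i where i: "i \<in> I" "z \<in> U i" using z D(3) I(2) by blast
      then have "1 - e \<le> (\<Sum>n<i. f n z)" by (simp add: U_def)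
      also have "\<dots> \<le> (\<Sum>n<N. f n z)"
        using N[OF i(1)] coversD(2)[OF f z] by (intro sum_mono2) auto
      finally show ?thesis .
    qed
    then have "L (\<lambda>z. 1 - e) \<le> L (\<lambda>z. \<Sum>n<N. f n z)"
      by (intro L_mono cont) auto
    then have "1 - e \<le> (\<Sum>n<N. L (f n))"
      using coversD(1)[OF f] by (simp add: L_const L_sum)
    then have "1 \<le> (\<Sum>n<N. L (f n)) + e" by simp
    then have "ennreal 1 \<le> ennreal ((\<Sum>n<N. L (f n)) + e)" by (rule ennreal_leI)
    also have "\<dots> = (\<Sum>n<N. ennreal (L (f n))) + ennreal e"
      using e coversD(4)[OF f] by (simp add: ennreal_plus sum_nonneg sum_ennreal)
    also have "\<dots> \<le> (\<Sum>n. ennreal (L (f n))) + ennreal e"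
      by (intro add_mono sum_le_suminf) auto
    finally show "1 \<le> (\<Sum>n. ennreal (L (f n))) + ennreal e" by simp
  qed
  then show "1 \<le> outer K" by (auto simp: outer_def intro!: INF_greatest)
qed

text \<open>Covers of \<open>A i\<close> with error \<open>e / 2 ^ (i + 1)\<close> are merged into
  one sequence through the enumeration \<open>prod_decode\<close> of pairs. They exist because
  \<open>outer\<close> is finite.\<close>

lemma outer_measure_space_outer: "outer_measure_space (Pow K) outer"
  unfolding outer_measure_space_def
proof (intro conjI)
  show "positive (Pow K) outer" by (simp add: positive_def outer_empty)
  show "increasing (Pow K) outer" by (simp add: increasing_def outer_mono)
  show "countably_subadditive (Pow K) outer"
    unfolding countably_subadditive_def
  proof (intro allI impI, rule ennreal_le_epsilon)
    fix A :: "nat \<Rightarrow> 'z set" and e :: real assume e: "0 < e"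
    have "\<exists>f. covers (A i) f \<and> (\<Sum>n. ennreal (L (f n))) < outer (A i) + e * (1/2) ^ Suc i" for i
    proof -
      have "outer (A i) \<noteq> \<infinity>" using outer_le_one[of "A i"] by (metis ennreal_one_neq_top infinity_ennreal_def top_unique)
      from INF_approx_ennreal[OF _ outer_def this, of "e * (1/2) ^ Suc i"] e show ?thesis by auto
    qed
    then obtain f where f: "\<And>i. covers (A i) (f i)"
      and Lf: "\<And>i. (\<Sum>n. ennreal (L (f i n))) < outer (A i) + e * (1/2) ^ Suc i"
      by metis
    define h where "h = case_prod f \<circ> prod_decode"
    have h: "(\<Sum>k. F (h k)) = (\<Sum>i. \<Sum>n. F (f i n))" for F :: "_ \<Rightarrow> ennreal"
      using suminf_ennreal_2dimen[of "\<lambda>i. \<Sum>n. F (f i n)" "\<lambda>(i, n). F (f i n)"]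
      by (simp add: h_def case_prod_beta)
    have "covers (\<Union>i. A i) h"
      unfolding covers_def
    proof (intro conjI allI ballI)
      fix z assume "z \<in> (\<Union>i. A i)"
      then obtain i where i: "z \<in> A i" by blast
      have "1 \<le> (\<Sum>n. ennreal (f i n z))" by (rule coversD(3)[OF f i])
      also have "\<dots> \<le> (\<Sum>i. \<Sum>n. ennreal (f i n z))"
        using sum_le_suminf[of "\<lambda>i. \<Sum>n. ennreal (f i n z)" "{i}"] by simp
      finally show "1 \<le> (\<Sum>k. ennreal (h k z))" by (simp add: h[of "\<lambda>h. ennreal (h z)"])
    qed (auto simp: h_def case_prod_beta intro: coversD(1,2)[OF f])
    then have "outer (\<Union>i. A i) \<le> (\<Sum>k. ennreal (L (h k)))" by (rule outer_le)
    also have "\<dots> = (\<Sum>i. \<Sum>n. ennreal (L (f i n)))" by (rule h)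
    also have "\<dots> \<le> (\<Sum>i. outer (A i) + e * (1/2) ^ Suc i)"
      by (intro suminf_le less_imp_le[OF Lf]) auto
    also have "\<dots> = (\<Sum>i. outer (A i)) + (\<Sum>i. ennreal e * ennreal ((1/2) ^ Suc i))"
      using e by (subst suminf_add[symmetric])
        (auto simp del: ennreal_suminf_cmult simp add: ennreal_mult[symmetric])
    also have "\<dots> = (\<Sum>i. outer (A i)) + e"
      unfolding ennreal_suminf_cmult
      by (subst suminf_ennreal_eq[OF zero_le_power power_half_series]) auto
    finally show "outer (\<Union>i. A i) \<le> (\<Sum>i. outer (A i)) + ennreal e" .
  qed
qed

text \<open>A cover \<open>f\<close> of \<open>E\<close> is split along \<open>u k = min 1 (k g)\<close>, which increases to the indicator of
  \<open>{g > 0}\<close>: the increments \<open>f n (u (k + 1) - u k)\<close> cover the part of \<open>E\<close> inside, and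
  \<open>f n (1 - u k)\<close> the part outside.\<close>

lemma outer_split:
  fixes g :: "'z \<Rightarrow> real"
  assumes g: "continuous_on K g" "\<And>z. z \<in> K \<Longrightarrow> 0 \<le> g z" and E: "E \<subseteq> K"
  shows "outer ({z\<in>K. 0 < g z} \<inter> E) + outer ((K - {z\<in>K. 0 < g z}) \<inter> E) \<le> outer E"
proof -
  let ?A = "{z\<in>K. 0 < g z}"
  define u where "u k z = min 1 (real k * g z)" for k z
  have u_cont: "continuous_on K (u k)" for k
    unfolding u_def by (intro continuous_intros g)
  have u_mono: "u k z \<le> u (Suc k) z" if "z \<in> K" for k z
    using g(2)[OF that] by (auto simp: u_def min_def distrib_right)
  have u_range: "0 \<le> u k z" "u k z \<le> 1" if "z \<in> K" for k z
    using g(2)[OF that] by (auto simp: u_def)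
  have u_lim: "(\<lambda>k. u k z) \<longlonglongrightarrow> 1" if z: "z \<in> ?A" for z
  proof -
    obtain k0 where k0: "1 < real k0 * g z" using reals_Archimedean3[of "g z"] z by blast
    have "u k z = 1" if "k0 \<le> k" for k
    proof -
      have "real k0 * g z \<le> real k * g z" using that z by (intro mult_right_mono) auto
      with k0 show ?thesis by (simp add: u_def)
    qed
    then show ?thesis by (intro tendsto_eventually eventually_sequentiallyI[of k0])
  qed
  have "outer (?A \<inter> E) + outer ((K - ?A) \<inter> E) \<le> (\<Sum>n. ennreal (L (f n)))" if f: "covers E f" for f
  proof -
    note f' = coversD[OF f]
    define h where "h n k z = f n z * (u (Suc k) z - u k z)" for n k z
    have h_cont: "continuous_on K (h n k)" for n k
      unfolding h_def by (intro continuous_intros f' u_cont)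
    have h_nonneg: "0 \<le> h n k z" if "z \<in> K" for n k z
      using f'(2)[OF that] u_mono[OF that] by (simp add: h_def)
    have h_sum: "(\<Sum>k. ennreal (h n k z)) = ennreal (f n z)" if z: "z \<in> ?A" for n z
    proof (rule suminf_ennreal_eq)
      have "(\<lambda>k. u (Suc k) z - u k z) sums (1 - u 0 z)"
        by (rule telescope_sums[OF u_lim[OF z]])
      from sums_mult[OF this, of "f n z"] show "(\<lambda>k. h n k z) sums f n z"
        by (simp add: h_def u_def)
    qed (use z h_nonneg in auto)
    define H where "H = (\<lambda>(n, k). h n k) \<circ> prod_decode"
    have H: "(\<Sum>j. F (H j)) = (\<Sum>n. \<Sum>k. F (h n k))" for F :: "_ \<Rightarrow> ennreal"
      using suminf_ennreal_2dimen[of "\<lambda>n. \<Sum>k. F (h n k)" "\<lambda>(n, k). F (h n k)"]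
      by (simp add: H_def case_prod_beta)
    have "covers (?A \<inter> E) H"
      unfolding covers_def
    proof (intro conjI allI ballI)
      fix z assume "z \<in> ?A \<inter> E"
      then show "1 \<le> (\<Sum>j. ennreal (H j z))"
        using f'(3) by (simp add: H[of "\<lambda>h. ennreal (h z)"] h_sum)
    qed (auto simp: H_def case_prod_beta intro: h_cont h_nonneg)
    then have "outer (?A \<inter> E) \<le> (\<Sum>n. \<Sum>k. ennreal (L (h n k)))"
      using outer_le H[of "\<lambda>h. ennreal (L h)"] by metis
    also have "\<dots> = (\<Sum>n. SUP m. ennreal (L (\<lambda>z. f n z * u m z)))"
    proof (intro suminf_cong)
      fix n
      have "(\<Sum>k<m. ennreal (L (h n k))) = ennreal (L (\<lambda>z. f n z * u m z))" for m
      proof -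
        have "(\<Sum>k<m. ennreal (L (h n k))) = ennreal (\<Sum>k<m. L (h n k))"
          by (intro sum_ennreal nonneg h_cont h_nonneg)
        also have "(\<Sum>k<m. L (h n k)) = L (\<lambda>z. \<Sum>k<m. h n k z)"
          by (intro L_sum[symmetric] h_cont)
        also have "(\<lambda>z. \<Sum>k<m. h n k z) = (\<lambda>z. f n z * u m z)"
          by (simp add: h_def sum_distrib_left[symmetric] sum_lessThan_telescope[of "\<lambda>k. u k z" for z])
            (simp add: u_def)
        finally show ?thesis .
      qed
      then show "(\<Sum>k. ennreal (L (h n k))) = (SUP m. ennreal (L (\<lambda>z. f n z * u m z)))"
        by (simp add: suminf_eq_SUP)
    qed
    also have "\<dots> = (SUP m. \<Sum>n. ennreal (L (\<lambda>z. f n z * u m z)))"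
      by (intro ennreal_suminf_SUP_eq incseq_SucI ennreal_leI L_mono mult_left_mono
          continuous_intros f' u_cont u_mono)
    \<comment> \<open>The outside part is estimated for each \<open>m\<close> separately, with the
      same \<open>m\<close> as inside, so its outer measure moves under the supremum.\<close>
    finally have "outer (?A \<inter> E) + outer ((K - ?A) \<inter> E)
        \<le> (SUP m. (\<Sum>n. ennreal (L (\<lambda>z. f n z * u m z))) + outer ((K - ?A) \<inter> E))"
      by (simp add: ennreal_SUP_add_left add_right_mono)
    also have "\<dots> \<le> (\<Sum>n. ennreal (L (f n)))"
    proof (rule SUP_least)
      fix m
      have nn: "0 \<le> L (\<lambda>z. f n z * (1 - u m z))" "0 \<le> L (\<lambda>z. f n z * u m z)" for n
        using u_range f'(2) by (auto intro!: nonneg continuous_intros f' u_cont)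
      have "covers ((K - ?A) \<inter> E) (\<lambda>n z. f n z * (1 - u m z))"
        unfolding covers_def
      proof (intro conjI allI ballI)
        fix z assume z: "z \<in> (K - ?A) \<inter> E"
        \<comment> \<open>Hence \<open>u m z = 0\<close>, and the factor \<open>1 - u m z\<close>
          leaves the cover unchanged at \<open>z\<close>.\<close>
        then have "g z = 0" using g(2)[of z] by force
        then show "1 \<le> (\<Sum>n. ennreal (f n z * (1 - u m z)))"
          using z f'(3)[of z] by (simp add: u_def)
      qed (use u_range f'(2) in \<open>auto intro!: continuous_intros f' u_cont\<close>)
      then have "outer ((K - ?A) \<inter> E) \<le> (\<Sum>n. ennreal (L (\<lambda>z. f n z * (1 - u m z))))"
        by (rule outer_le)
      then have "(\<Sum>n. ennreal (L (\<lambda>z. f n z * u m z))) + outer ((K - ?A) \<inter> E)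
          \<le> (\<Sum>n. ennreal (L (\<lambda>z. f n z * u m z)) + ennreal (L (\<lambda>z. f n z * (1 - u m z))))"
        by (subst suminf_add[symmetric]) (auto intro: add_left_mono)
      also have "\<dots> = (\<Sum>n. ennreal (L (f n)))"
      proof (intro suminf_cong)
        fix n
        have "L (f n) = L (\<lambda>z. f n z * u m z + f n z * (1 - u m z))"
          by (simp add: algebra_simps)
        also have "\<dots> = L (\<lambda>z. f n z * u m z) + L (\<lambda>z. f n z * (1 - u m z))"
          by (intro L_add continuous_intros f' u_cont)
        finally show "ennreal (L (\<lambda>z. f n z * u m z)) + ennreal (L (\<lambda>z. f n z * (1 - u m z)))
            = ennreal (L (f n))"
          using nn by (simp add: ennreal_plus)
      qed
      finally show "(\<Sum>n. ennreal (L (\<lambda>z. f n z * u m z))) + outer ((K - ?A) \<inter> E)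
          \<le> (\<Sum>n. ennreal (L (f n)))" .
    qed
    finally show ?thesis .
  qed
  then show ?thesis by (subst (3) outer_def) (auto intro!: INF_greatest)
qed

text \<open>Caratheodory's theorem: the sets that split every \<open>E\<close> additively form a
  sigma-algebra on which \<open>outer\<close> is a measure. By \<open>outer_split\<close> it
  contains each \<open>{g > 0}\<close>, by \<open>cozero\<close> each relatively open set, hence all
  Borel sets of \<open>K\<close>.\<close>

lemma measure_space_outer: "measure_space K (sets (restrict_space borel K)) outer"
proof -
  interpret P: sigma_algebra K "Pow K" by (rule sigma_algebra_Pow)
  let ?S = "lambda_system K (Pow K) outer"
  have pos: "positive (Pow K) outer" and csa: "countably_subadditive (Pow K) outer"
    using outer_measure_space_outer by (auto simp: outer_measure_space_def)
  have sub: "subadditive (Pow K) outer"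
    by (rule P.countably_subadditive_subadditive[OF pos csa])
  have ms: "measure_space K ?S outer"
    by (rule P.caratheodory_lemma[OF outer_measure_space_outer])
  interpret S: sigma_algebra K ?S
    using ms by (simp add: measure_space_def)
  have positive_set: "{z\<in>K. 0 < g z} \<in> ?S"
    if "continuous_on K g" "\<And>z. z \<in> K \<Longrightarrow> 0 \<le> g z" for g :: "'z \<Rightarrow> real"
    unfolding lambda_system_def
  proof (intro CollectI conjI ballI antisym)
    fix E assume E: "E \<in> Pow K"
    let ?A = "{z\<in>K. 0 < g z}"
    have "outer ((?A \<inter> E) \<union> ((K - ?A) \<inter> E)) \<le> outer (?A \<inter> E) + outer ((K - ?A) \<inter> E)"
      using E by (intro subadditiveD[OF sub]) auto
    moreover have "(?A \<inter> E) \<union> ((K - ?A) \<inter> E) = E" using E by auto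
    ultimately show "outer E \<le> outer (?A \<inter> E) + outer ((K - ?A) \<inter> E)" by simp
    show "outer (?A \<inter> E) + outer ((K - ?A) \<inter> E) \<le> outer E"
      using that E by (intro outer_split) auto
  qed auto
  have "K \<inter> B \<in> ?S" if "B \<in> sets borel" for B
  proof -
    have "B \<in> sigma_sets UNIV {S. open S}" using that by (simp add: borel_def)
    then show ?thesis
    proof induction
      case (Basic U)
      then show ?case using cozero[of U] positive_set by fastforce
    next
      case (Compl B)
      have "K \<inter> (UNIV - B) = K - (K \<inter> B)" by auto
      with Compl show ?case by (simp add: S.compl_sets)
    next
      case (Union B)
      have "K \<inter> (\<Union>i. B i) = (\<Union>i. K \<inter> B i)" by auto
      moreover have "(\<Union>i. K \<inter> B i) \<in> ?S" using Union by (intro S.countable_UN) auto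
      ultimately show ?case by simp
    qed simp
  qed
  then have "sets (restrict_space borel K) \<subseteq> ?S" by (auto simp: sets_restrict_space)
  moreover have "sigma_algebra K (sets (restrict_space borel K))"
    using sets.sigma_algebra_axioms[of "restrict_space borel K"] by (simp add: space_restrict_space)
  ultimately show ?thesis using measure_down[OF ms] by blast
qed

section \<open>The representing measure and its integrals\<close>

definition riesz_measure :: "'z measure" where
  "riesz_measure = measure_of K (sets (restrict_space borel K)) outer"

lemma sets_riesz_measure: "sets riesz_measure = sets (restrict_space borel K)"
  and space_riesz_measure: "space riesz_measure = K"
proof -
  have sa: "sigma_algebra K (sets (restrict_space borel K))"
    using measure_space_outer by (simp add: measure_space_def)
  then show "sets riesz_measure = sets (restrict_space borel K)"
    by (simp add: riesz_measure_def sigma_algebra.sets_measure_of_eq)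
  show "space riesz_measure = K"
    using sa by (simp add: riesz_measure_def sigma_algebra.space_measure_of_eq)
qed

lemma emeasure_riesz_measure:
  "A \<in> sets (restrict_space borel K) \<Longrightarrow> emeasure riesz_measure A = outer A"
  using measure_space_outer
  by (simp add: riesz_measure_def measure_space_def emeasure_measure_of_sigma)

lemma prob_space_riesz_measure: "prob_space riesz_measure"
proof
  have "K \<in> sets (restrict_space borel K)"
    using sets.top[of "restrict_space borel K"] by (simp add: space_restrict_space)
  then show "emeasure riesz_measure (space riesz_measure) = 1"
    by (simp add: space_riesz_measure emeasure_riesz_measure outer_space)
qed

lemma riesz_measure_in_borel_probs: "riesz_measure \<in> borel_probs K"
  using prob_space_riesz_measure sets_riesz_measure by (simp add: borel_probs_def)

lemmas continuous_integrable_riesz_measure =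
  integrable_continuous_on_compact[OF riesz_measure_in_borel_probs compact_K]

text \<open>Cut \<open>g\<close> into the layers \<open>min g ((k + 1) / N) - min g (k / N)\<close>; times \<open>N\<close>, each of
  them covers \<open>{g \<ge> (k + 1) / N}\<close> and vanishes outside \<open>{g \<ge> k / N}\<close>.\<close>

lemma integral_riesz_measure_le:
  assumes g: "continuous_on K g" "\<And>z. z \<in> K \<Longrightarrow> 0 \<le> g z" "\<And>z. z \<in> K \<Longrightarrow> g z \<le> 1"
  shows "(\<integral>z. g z \<partial>riesz_measure) \<le> L g"
proof (rule field_le_epsilon)
  interpret prob_space riesz_measure by (rule prob_space_riesz_measure)
  fix e :: real assume "0 < e"
  then obtain N where N: "N \<noteq> 0" "1 / real N < e"
    using real_arch_inverse[of e] by (auto simp: inverse_eq_divide)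
  define t where "t k = real k / real N" for k
  have t_mono: "t k \<le> t (Suc k)" for k using N by (simp add: t_def divide_right_mono)
  have t_N: "t N = 1" and t_0: "t 0 = 0" using N by (auto simp: t_def)
  define A where "A k = {z\<in>K. t k \<le> g z}" for k
  define v where "v k z = min (g z) (t (Suc k)) - min (g z) (t k)" for k z
  have v_cont: "continuous_on K (v k)" for k
    unfolding v_def by (intro continuous_intros g)
  have v_sum: "(\<Sum>k<N. v k z) = g z" if "z \<in> K" for z
    using g(2,3)[OF that] sum_lessThan_telescope[of "\<lambda>k. min (g z) (t k)" N]
    by (simp add: v_def t_N t_0)
  have v_nonneg: "0 \<le> v k z" for k z using t_mono[of k] by (simp add: v_def)
  have A_sets: "A k \<in> sets riesz_measure" for k
  proof -
    have "{z \<in> space riesz_measure. t k \<le> g z} \<in> sets riesz_measure"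
      using borel_measurable_continuous_on_borel_probs[OF riesz_measure_in_borel_probs g(1)] by measurable
    then show ?thesis by (simp add: A_def space_riesz_measure)
  qed
  have A_le: "measure riesz_measure (A (Suc k)) \<le> real N * L (v k)" for k
  proof -
    have diff: "t (Suc k) - t k = 1 / real N" by (simp add: t_def diff_divide_distrib[symmetric])
    have "emeasure riesz_measure (A (Suc k)) = outer (A (Suc k))"
      using A_sets by (intro emeasure_riesz_measure) (simp add: sets_riesz_measure)
    also have "\<dots> \<le> ennreal (L (\<lambda>z. real N * v k z))"
    proof (rule outer_le_single)
      fix z assume "z \<in> A (Suc k)"
      then have "v k z = 1 / real N"
        using t_mono[of k] diff by (auto simp: A_def v_def)
      then show "1 \<le> real N * v k z" using N by simp
    qed (auto intro!: continuous_intros v_cont v_nonneg mult_nonneg_nonneg)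
    also have "L (\<lambda>z. real N * v k z) = real N * L (v k)"
      by (rule L_scale[OF v_cont])
    finally have "ennreal (measure riesz_measure (A (Suc k))) \<le> ennreal (real N * L (v k))"
      by (simp add: emeasure_eq_measure)
    moreover have "0 \<le> L (v k)" by (intro nonneg v_cont v_nonneg)
    ultimately show ?thesis by (simp add: ennreal_le_iff)
  qed
  have g_le: "g z \<le> 1 / N + (\<Sum>k<N. 1 / N * indicat_real (A (Suc k)) z)" if z: "z \<in> K" for z
  proof -
    have "v k z \<le> 1 / N * indicat_real (A k) z" for k
    proof (cases "z \<in> A k")
      case True
      have "v k z \<le> t (Suc k) - t k" using t_mono[of k] by (auto simp: v_def min_def)
      also have "\<dots> = 1 / N" by (simp add: t_def diff_divide_distrib[symmetric])
      finally show ?thesis using True by simp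
    next
      case False
      then have "g z < t k" using z by (auto simp: A_def)
      with False t_mono[of k] show ?thesis by (simp add: v_def)
    qed
    then have "g z \<le> (\<Sum>k<N. 1 / N * indicat_real (A k) z)"
      unfolding v_sum[OF z, symmetric] by (rule sum_mono)
    \<comment> \<open>A layer vanishes only off \<open>A k\<close>, whereas \<open>A_le\<close>
      bounds the measure of \<open>A (Suc k)\<close>. Shifting the index costs the single term of
      \<open>A 0 = K\<close>, that is \<open>1 / N\<close>.\<close>
    also have "\<dots> \<le> (\<Sum>k<Suc N. 1 / N * indicat_real (A k) z)"
      by (rule sum_mono2) auto
    also have "\<dots> = 1 / N * indicat_real (A 0) z + (\<Sum>k<N. 1 / N * indicat_real (A (Suc k)) z)"
      by (rule sum.lessThan_Suc_shift)
    also have "1 / N * indicat_real (A 0) z \<le> 1 / N" by (simp add: indicator_def)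
    finally show ?thesis by simp
  qed
  have "(\<integral>z. g z \<partial>riesz_measure)
      \<le> (\<integral>z. 1 / N + (\<Sum>k<N. 1 / N * indicat_real (A (Suc k)) z) \<partial>riesz_measure)"
    using A_sets g_le
    by (intro integral_mono continuous_integrable_riesz_measure g(1) Bochner_Integration.integrable_add
        Bochner_Integration.integrable_sum integrable_mult_right integrable_real_indicator)
      (auto simp: space_riesz_measure less_top[symmetric])
  also have "\<dots> = 1 / N + (\<Sum>k<N. 1 / N * measure riesz_measure (A (Suc k)))"
    using A_sets by (simp add: prob_space sets.Int_space_eq2 less_top[symmetric])
  also have "(\<Sum>k<N. 1 / N * measure riesz_measure (A (Suc k))) \<le> (\<Sum>k<N. 1 / N * (real N * L (v k)))"
    by (intro sum_mono mult_left_mono A_le) auto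
  also have "\<dots> = (\<Sum>k<N. L (v k))" using N by simp
  also have "\<dots> = L (\<lambda>z. \<Sum>k<N. v k z)" by (intro L_sum[symmetric] v_cont)
  \<comment> \<open>\<open>v_sum\<close> holds on \<open>K\<close> only, so the two values are
    compared by monotonicity in both directions.\<close>
  also have "\<dots> = L g"
    by (intro antisym L_mono continuous_on_sum v_cont g) (auto simp: v_sum)
  finally show "(\<integral>z. g z \<partial>riesz_measure) \<le> L g + e" using N by simp
qed

text \<open>Applying the inequality to \<open>g\<close> and to \<open>1 - g\<close> gives equality.\<close>

lemma integral_riesz_measure:
  assumes h: "continuous_on K h"
  shows "(\<integral>z. h z \<partial>riesz_measure) = L h"
proof -
  interpret prob_space riesz_measure by (rule prob_space_riesz_measure)
  note int = continuous_integrable_riesz_measure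
  obtain B where "\<forall>z\<in>K. norm (h z) \<le> B"
    using compact_imp_bounded[OF compact_continuous_image[OF h compact_K]]
    by (auto simp: bounded_iff)
  define b where "b = \<bar>B\<bar> + 1"
  have b: "0 < b" "\<And>z. z \<in> K \<Longrightarrow> \<bar>h z\<bar> \<le> b"
    using \<open>\<forall>z\<in>K. norm (h z) \<le> B\<close> by (force simp: b_def)+
  \<comment> \<open>Since \<open>\<bar>h\<bar> \<le> b\<close> on \<open>K\<close>, this affine
    image of \<open>h\<close> lies between 0 and 1, as the one-sided bound requires.\<close>
  define g where "g z = 1 / 2 + 1 / (2 * b) * h z" for z
  have g_cont: "continuous_on K g" unfolding g_def by (intro continuous_intros h)
  have g01: "0 \<le> g z" "g z \<le> 1" if "z \<in> K" for z
    using b(2)[OF that] b(1) by (auto simp: g_def field_simps abs_le_iff)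
  have "(\<integral>z. 1 - g z \<partial>riesz_measure) \<le> L (\<lambda>z. 1 - g z)"
    using g01 by (intro integral_riesz_measure_le continuous_intros g_cont) auto
  then have "L g \<le> (\<integral>z. g z \<partial>riesz_measure)"
    using int[OF g_cont] g_cont by (simp add: L_diff one prob_space)
  moreover have "(\<integral>z. g z \<partial>riesz_measure) \<le> L g"
    by (intro integral_riesz_measure_le g_cont g01)
  moreover have "(\<integral>z. g z \<partial>riesz_measure) = 1 / 2 + 1 / (2 * b) * (\<integral>z. h z \<partial>riesz_measure)"
    unfolding g_def using int[OF h] by (simp add: prob_space)
  moreover have "L g = 1 / 2 + 1 / (2 * b) * L h"
  proof -
    have "L g = L (\<lambda>z. 1 / 2) + L (\<lambda>z. 1 / (2 * b) * h z)"
      unfolding g_def by (intro L_add continuous_intros h)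
    then show ?thesis by (simp only: L_scale[OF h] L_const)
  qed
  ultimately show ?thesis using b(1) by simp
qed

theorem riesz_representation:
  obtains M where "M \<in> borel_probs K" "\<And>h. continuous_on K h \<Longrightarrow> (\<integral>z. h z \<partial>M) = L h"
  using that riesz_measure_in_borel_probs integral_riesz_measure by blast

end

subsection \<open>Duality\<close>

lemma continuous_on_shift_map: "continuous_on S shift_map"
  unfolding shift_map_def
  by (intro continuous_on_coordinatewise_then_product
      continuous_on_subset[OF continuous_on_product_coordinates]) simp

lemma shift_map_in_full_shift: "y \<in> full_shift d \<Longrightarrow> shift_map y \<in> full_shift d"
  by (simp add: full_shift_def shift_map_def)

lemma continuous_on_compose_shift_map:
  "continuous_on (full_shift d) \<psi> \<Longrightarrow> continuous_on (full_shift d) (\<lambda>y. \<psi> (shift_map y))"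
  by (rule continuous_on_compose2[OF _ continuous_on_shift_map])
    (auto intro: shift_map_in_full_shift)

lemma compact_full_shift: "compact (full_shift d)"
proof -
  have "full_shift d = (\<Pi>\<^sub>E k\<in>UNIV. {1..d})"
    by (auto simp: full_shift_def PiE_iff)
  moreover have "compactin (product_topology (\<lambda>k::nat. euclidean) UNIV) (\<Pi>\<^sub>E k\<in>UNIV. {1..d})"
    by (simp add: compactin_PiE finite_imp_compact)
  ultimately show ?thesis
    by (simp add: euclidean_product_topology)
qed

locale shift_transport =
  fixes X :: "'a::metric_space set" and d :: nat and \<mu> :: "'a measure"
    and c :: "'a \<times> (nat \<Rightarrow> nat) \<Rightarrow> real"
  assumes compact_X: "compact X" and d: "1 \<le> d" and mu: "\<mu> \<in> borel_probs X"
    and cont_c: "continuous_on (X \<times> full_shift d) c"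
    and c_nonneg: "\<And>z. z \<in> X \<times> full_shift d \<Longrightarrow> 0 \<le> c z"
begin

abbreviation "Y \<equiv> full_shift d"

text \<open>At a fixed point of the shift every coboundary
  \<open>\<psi> - \<psi> \<circ> shift_map\<close> vanishes, so an inequality evaluated there bounds
  \<open>\<phi>\<close> alone.\<close>

definition fixed :: "nat \<Rightarrow> nat" where "fixed = (\<lambda>_. 1)"

lemma fixed_in: "fixed \<in> Y" using d by (simp add: fixed_def full_shift_def)

lemma shift_fixed: "shift_map fixed = fixed" by (simp add: fixed_def shift_map_def)

lemma compact_XY: "compact (X \<times> Y)"
  by (intro compact_Times compact_X compact_full_shift)

sublocale mu: prob_space \<mu> using mu by (simp add: borel_probs_def)

lemma X_nonempty: "X \<noteq> {}"
  using mu.not_empty space_borel_probs[OF mu] by simp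

lemmas integrable_mu = integrable_continuous_on_compact[OF mu compact_X]

lemma integral_mu_mono:
  fixes f g :: "'a \<Rightarrow> real"
  assumes "continuous_on X f" "continuous_on X g" "\<And>x. x \<in> X \<Longrightarrow> f x \<le> g x"
  shows "(\<integral>x. f x \<partial>\<mu>) \<le> (\<integral>x. g x \<partial>\<mu>)"
  using assms by (intro integral_mono integrable_mu) (auto simp: space_borel_probs[OF mu])

lemma cont_c_slice: "y \<in> Y \<Longrightarrow> continuous_on X (\<lambda>x. c (x, y))"
  by (rule continuous_on_compose2[OF cont_c]) (auto intro!: continuous_intros)

lemma continuous_on_fst_XY: "continuous_on X f \<Longrightarrow> continuous_on (X \<times> Y) (\<lambda>z. f (fst z))"
  by (rule continuous_on_compose2[of X f]) (auto intro!: continuous_intros)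

lemma continuous_on_snd_XY: "continuous_on Y g \<Longrightarrow> continuous_on (X \<times> Y) (\<lambda>z. g (snd z))"
  by (rule continuous_on_compose2[of Y g, OF _ continuous_on_snd[OF continuous_on_id]]) auto

lemma admissible_pairs_iff:
  "(\<phi>, \<psi>) \<in> admissible_pairs X d c \<longleftrightarrow> continuous_on X \<phi> \<and> continuous_on Y \<psi>
    \<and> (\<forall>x\<in>X. \<forall>y\<in>Y. \<phi> x + \<psi> y - \<psi> (shift_map y) \<le> c (x, y))"
  by (simp add: admissible_pairs_def)

section \<open>The dual value and weak duality\<close>

definition dual_value :: real where
  "dual_value = (SUP (\<phi>, \<psi>) \<in> admissible_pairs X d c. \<integral>x. \<phi> x \<partial>\<mu>)"

lemma admissible_integral_le_slice:
  assumes "(\<phi>, \<psi>) \<in> admissible_pairs X d c"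
  shows "(\<integral>x. \<phi> x \<partial>\<mu>) \<le> (\<integral>x. c (x, fixed) \<partial>\<mu>)"
proof (intro integral_mu_mono cont_c_slice fixed_in)
  show "\<phi> x \<le> c (x, fixed)" if "x \<in> X" for x
    using assms that fixed_in unfolding admissible_pairs_iff by (metis add_diff_cancel_right' shift_fixed)
qed (use assms in \<open>simp add: admissible_pairs_iff\<close>)

lemma bdd_above_dual: "bdd_above ((\<lambda>(\<phi>, \<psi>). \<integral>x. \<phi> x \<partial>\<mu>) ` admissible_pairs X d c)"
  using admissible_integral_le_slice by (intro bdd_aboveI2) auto

lemma admissible_zero: "(\<lambda>x. 0, \<lambda>y. 0) \<in> admissible_pairs X d c"
  using c_nonneg by (simp add: admissible_pairs_iff)

lemma integral_le_dual_value:
  assumes "(\<phi>, \<psi>) \<in> admissible_pairs X d c"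
  shows "(\<integral>x. \<phi> x \<partial>\<mu>) \<le> dual_value"
  using cSUP_upper[OF assms bdd_above_dual] by (simp add: dual_value_def)

lemma dual_value_approx:
  assumes "a < dual_value"
  obtains \<phi> \<psi> where "(\<phi>, \<psi>) \<in> admissible_pairs X d c" "a < (\<integral>x. \<phi> x \<partial>\<mu>)"
  using assms admissible_zero unfolding dual_value_def
  by (subst (asm) less_cSUP_iff[OF _ bdd_above_dual]) auto

text \<open>Links the extended-real supremum of the theorem to the real one used in the argument;
  they agree because the set of values is nonempty and bounded above.\<close>

lemma SUP_ereal_dual_value:
  "(SUP (\<phi>, \<psi>) \<in> admissible_pairs X d c. ereal (\<integral>x. \<phi> x \<partial>\<mu>)) = ereal dual_value"
proof (rule SUP_eqI)
  fix u assume u: "\<And>p. p \<in> admissible_pairs X d c \<Longrightarrow> (case p of (\<phi>, \<psi>) \<Rightarrow> ereal (\<integral>x. \<phi> x \<partial>\<mu>)) \<le> u"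
  show "ereal dual_value \<le> u"
  proof (rule ccontr)
    assume "\<not> ereal dual_value \<le> u"
    then obtain a where a: "u < ereal a" "a < dual_value"
      using ereal_dense2[of u "ereal dual_value"] by (auto simp: not_le)
    obtain \<phi> \<psi> where *: "(\<phi>, \<psi>) \<in> admissible_pairs X d c" "a < (\<integral>x. \<phi> x \<partial>\<mu>)"
      by (rule dual_value_approx[OF a(2)])
    then have "ereal a < ereal (\<integral>x. \<phi> x \<partial>\<mu>)" by simp
    also have "\<dots> \<le> u" using u[OF *(1)] by simp
    finally show False using a(1) by simp
  qed
qed (auto intro: integral_le_dual_value)

text \<open>Integrate the admissibility inequality against \<open>\<pi>\<close>: the marginal
  condition produces the \<open>\<mu>\<close>-integral, and the two \<open>\<psi>\<close> terms
  cancel by invariance.\<close>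

lemma weak_duality:
  assumes \<pi>: "\<pi> \<in> plans X d \<mu>"
  shows "dual_value \<le> (\<integral>z. c z \<partial>\<pi>)"
proof (rule dense_le)
  fix a assume "a < dual_value"
  then obtain \<phi> \<psi> where adm: "(\<phi>, \<psi>) \<in> admissible_pairs X d c" and a: "a < (\<integral>x. \<phi> x \<partial>\<mu>)"
    by (rule dual_value_approx)
  have \<pi>b: "\<pi> \<in> borel_probs (X \<times> Y)" using \<pi> by (simp add: plans_def)
  note int = integrable_continuous_on_compact[OF \<pi>b compact_XY]
  have cont: "continuous_on X \<phi>" "continuous_on Y \<psi>" using adm by (auto simp: admissible_pairs_iff)
  note i1 = int[OF continuous_on_fst_XY[OF cont(1)]]
  note i2 = int[OF continuous_on_snd_XY[OF cont(2)]]
  note i3 = int[OF continuous_on_snd_XY[OF continuous_on_compose_shift_map[OF cont(2)]]]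
  have "(\<integral>x. \<phi> x \<partial>\<mu>) = (\<integral>z. \<phi> (fst z) \<partial>\<pi>) + (\<integral>z. \<psi> (snd z) \<partial>\<pi>) - (\<integral>z. \<psi> (shift_map (snd z)) \<partial>\<pi>)"
    using \<pi> cont by (simp add: plans_def)
  also have "\<dots> = (\<integral>z. \<phi> (fst z) + \<psi> (snd z) - \<psi> (shift_map (snd z)) \<partial>\<pi>)"
    using i1 i2 i3 by simp
  also have "\<dots> \<le> (\<integral>z. c z \<partial>\<pi>)"
    using adm by (intro integral_mono int cont_c Bochner_Integration.integrable_diff
        Bochner_Integration.integrable_add i1 i2 i3)
      (auto simp: space_borel_probs[OF \<pi>b] admissible_pairs_iff)
  finally show "a \<le> (\<integral>z. c z \<partial>\<pi>)" using a by simp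
qed

text \<open>A linear functional below \<open>majorant\<close> has the prescribed marginal (\<open>t = 0\<close>, \<open>\<psi> = 0\<close>), is
  shift invariant (\<open>t = 0\<close>, \<open>\<phi> = 0\<close>), is positive, and takes a value at most \<open>dual_value\<close> at
  \<open>c\<close> (\<open>t = 1\<close>).\<close>

definition majorant_values :: "('a \<times> (nat \<Rightarrow> nat) \<Rightarrow> real) \<Rightarrow> real set" where
  "majorant_values h = {(\<integral>x. \<phi> x \<partial>\<mu>) + t * dual_value | \<phi> \<psi> t.
     continuous_on X \<phi> \<and> continuous_on Y \<psi> \<and> 0 \<le> t \<and>
     (\<forall>x\<in>X. \<forall>y\<in>Y. h (x, y) \<le> \<phi> x + \<psi> y - \<psi> (shift_map y) + t * c (x, y))}"

definition majorant :: "('a \<times> (nat \<Rightarrow> nat) \<Rightarrow> real) \<Rightarrow> real" where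
  "majorant h = Inf (majorant_values h)"

text \<open>This keeps \<open>majorant\<close> finite. For \<open>t = 0\<close> the inequality at
  \<open>fixed\<close> reads \<open>m \<le> \<phi> x\<close>. For \<open>t > 0\<close>, division by
  \<open>t\<close> makes \<open>((m - \<phi>) / t, - \<psi> / t)\<close> an admissible pair, whose
  integral is at most \<open>dual_value\<close>.\<close>

lemma majorant_values_lower:
  assumes v: "v \<in> majorant_values h" and m: "\<And>z. z \<in> X \<times> Y \<Longrightarrow> m \<le> h z"
  shows "m \<le> v"
proof -
  obtain \<phi> \<psi> t where \<phi>: "continuous_on X \<phi>" and \<psi>: "continuous_on Y \<psi>" and t: "0 \<le> t"
    and le: "\<And>x y. x \<in> X \<Longrightarrow> y \<in> Y \<Longrightarrow> h (x, y) \<le> \<phi> x + \<psi> y - \<psi> (shift_map y) + t * c (x, y)"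
    and v: "v = (\<integral>x. \<phi> x \<partial>\<mu>) + t * dual_value"
    using v unfolding majorant_values_def by blast
  have le: "m \<le> \<phi> x + \<psi> y - \<psi> (shift_map y) + t * c (x, y)" if "x \<in> X" "y \<in> Y" for x y
    using le[OF that] m[of "(x, y)"] that by auto
  have const: "(\<integral>x. m \<partial>\<mu>) = m" by (simp add: mu.prob_space)
  show ?thesis
  proof (cases "t = 0")
    case True
    have "m \<le> \<phi> x" if "x \<in> X" for x
      using le[OF that fixed_in] True by (simp add: shift_fixed)
    then have "(\<integral>x. m \<partial>\<mu>) \<le> (\<integral>x. \<phi> x \<partial>\<mu>)"
      by (intro integral_mu_mono \<phi>) auto
    then have "m \<le> (\<integral>x. \<phi> x \<partial>\<mu>)" unfolding const .
    then show ?thesis using True v by simp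
  next
    case False
    with t have t: "0 < t" by simp
    have "(m - \<phi> x) / t + (- \<psi> y / t) - (- \<psi> (shift_map y) / t) \<le> c (x, y)"
      if "x \<in> X" "y \<in> Y" for x y
    proof -
      have "(m - \<phi> x) / t + (- \<psi> y / t) - (- \<psi> (shift_map y) / t)
          = (m - \<phi> x - \<psi> y + \<psi> (shift_map y)) / t"
        by (simp add: diff_divide_distrib add_divide_distrib)
      also have "\<dots> \<le> c (x, y)"
        using le[OF that] t by (simp add: pos_divide_le_eq algebra_simps)
      finally show ?thesis .
    qed
    then have "(\<lambda>x. (m - \<phi> x) / t, \<lambda>y. - \<psi> y / t) \<in> admissible_pairs X d c"
      using t unfolding admissible_pairs_iff by (auto intro!: continuous_intros \<phi> \<psi>)
    then have "(\<integral>x. (m - \<phi> x) / t \<partial>\<mu>) \<le> dual_value" by (rule integral_le_dual_value)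
    moreover have "(\<integral>x. (m - \<phi> x) / t \<partial>\<mu>) = (m - (\<integral>x. \<phi> x \<partial>\<mu>)) / t"
      using integrable_mu[OF \<phi>] by (simp add: mu.prob_space)
    ultimately show ?thesis using t v by (simp add: field_simps)
  qed
qed

lemma majorant_le:
  assumes h: "continuous_on (X \<times> Y) h" and "continuous_on X \<phi>" "continuous_on Y \<psi>" "0 \<le> t"
    and "\<And>x y. x \<in> X \<Longrightarrow> y \<in> Y \<Longrightarrow> h (x, y) \<le> \<phi> x + \<psi> y - \<psi> (shift_map y) + t * c (x, y)"
  shows "majorant h \<le> (\<integral>x. \<phi> x \<partial>\<mu>) + t * dual_value"
proof -
  obtain B where "\<forall>z\<in>X \<times> Y. norm (h z) \<le> B"
    using compact_imp_bounded[OF compact_continuous_image[OF h compact_XY]]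
    by (auto simp: bounded_iff)
  then have "- B \<le> v" if "v \<in> majorant_values h" for v
    by (intro majorant_values_lower[OF that]) (force simp: abs_le_iff)
  then have "bdd_below (majorant_values h)" by (rule bdd_belowI)
  moreover have "(\<integral>x. \<phi> x \<partial>\<mu>) + t * dual_value \<in> majorant_values h"
    unfolding majorant_values_def using assms by blast
  ultimately show ?thesis by (simp add: majorant_def cInf_lower)
qed

lemma majorant_values_nonempty:
  assumes h: "continuous_on (X \<times> Y) h"
  shows "majorant_values h \<noteq> {}"
proof -
  obtain B where "\<forall>z\<in>X \<times> Y. norm (h z) \<le> B"
    using compact_imp_bounded[OF compact_continuous_image[OF h compact_XY]]
    by (auto simp: bounded_iff)
  then have "h (x, y) \<le> B" if "x \<in> X" "y \<in> Y" for x y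
    using that by (force simp: abs_le_iff)
  then have "(\<integral>x. B \<partial>\<mu>) + 0 * dual_value \<in> majorant_values h"
    unfolding majorant_values_def
    by (intro CollectI exI[of _ "\<lambda>x. B"] exI[of _ "\<lambda>y. 0"] exI[of _ 0]) auto
  then show ?thesis by blast
qed

lemma majorant_greatest:
  assumes "continuous_on (X \<times> Y) h"
    and "\<And>\<phi> \<psi> t. continuous_on X \<phi> \<Longrightarrow> continuous_on Y \<psi> \<Longrightarrow> 0 \<le> t \<Longrightarrow>
      (\<And>x y. x \<in> X \<Longrightarrow> y \<in> Y \<Longrightarrow> h (x, y) \<le> \<phi> x + \<psi> y - \<psi> (shift_map y) + t * c (x, y)) \<Longrightarrow>
      m \<le> (\<integral>x. \<phi> x \<partial>\<mu>) + t * dual_value"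
  shows "m \<le> majorant h"
  unfolding majorant_def
proof (rule cInf_greatest[OF majorant_values_nonempty[OF assms(1)]])
  show "m \<le> v" if "v \<in> majorant_values h" for v
    using that unfolding majorant_values_def by (auto intro: assms(2))
qed

text \<open>The triples \<open>(\<phi>, \<psi>, t)\<close> form a convex cone, and both the
  majorizing function and its value are linear in them. The two infima are taken one after the
  other, hence the nested \<open>majorant_greatest\<close>.\<close>

lemma sublinear_majorant: "sublinear_on {h. continuous_on (X \<times> Y) h} majorant"
proof (rule sublinear_onI[OF function_subspace_continuous_on])
  fix f g :: "_ \<Rightarrow> real"
  assume "f \<in> {h. continuous_on (X \<times> Y) h}" "g \<in> {h. continuous_on (X \<times> Y) h}"
  then have f: "continuous_on (X \<times> Y) f" and g: "continuous_on (X \<times> Y) g" by auto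
  have "majorant (\<lambda>z. f z + g z) - majorant f \<le> majorant g"
  proof (rule majorant_greatest[OF g])
    fix \<phi>' \<psi>' t' assume 1: "continuous_on X \<phi>'" "continuous_on Y \<psi>'" "0 \<le> t'"
      "\<And>x y. x \<in> X \<Longrightarrow> y \<in> Y \<Longrightarrow> g (x, y) \<le> \<phi>' x + \<psi>' y - \<psi>' (shift_map y) + t' * c (x, y)"
    have "majorant (\<lambda>z. f z + g z) - ((\<integral>x. \<phi>' x \<partial>\<mu>) + t' * dual_value) \<le> majorant f"
    proof (rule majorant_greatest[OF f])
      fix \<phi> \<psi> t assume 2: "continuous_on X \<phi>" "continuous_on Y \<psi>" "0 \<le> t"
        "\<And>x y. x \<in> X \<Longrightarrow> y \<in> Y \<Longrightarrow> f (x, y) \<le> \<phi> x + \<psi> y - \<psi> (shift_map y) + t * c (x, y)"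
      have "majorant (\<lambda>z. f z + g z) \<le> (\<integral>x. \<phi> x + \<phi>' x \<partial>\<mu>) + (t + t') * dual_value"
      proof (rule majorant_le[where \<psi> = "\<lambda>y. \<psi> y + \<psi>' y"])
        show "f (x, y) + g (x, y) \<le> \<phi> x + \<phi>' x + (\<psi> y + \<psi>' y)
            - (\<psi> (shift_map y) + \<psi>' (shift_map y)) + (t + t') * c (x, y)"
          if "x \<in> X" "y \<in> Y" for x y
          using add_mono[OF 2(4)[OF that] 1(4)[OF that]] by (simp add: algebra_simps)
      qed (use 1(3) 2(3) in \<open>auto intro!: continuous_intros f g 1(1,2) 2(1,2)\<close>)
      then show "majorant (\<lambda>z. f z + g z) - ((\<integral>x. \<phi>' x \<partial>\<mu>) + t' * dual_value)
          \<le> (\<integral>x. \<phi> x \<partial>\<mu>) + t * dual_value"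
        using integrable_mu[OF 1(1)] integrable_mu[OF 2(1)] by (simp add: algebra_simps)
    qed
    then show "majorant (\<lambda>z. f z + g z) - majorant f \<le> (\<integral>x. \<phi>' x \<partial>\<mu>) + t' * dual_value"
      by simp
  qed
  then show "majorant (\<lambda>z. f z + g z) \<le> majorant f + majorant g" by simp
next
  fix f :: "_ \<Rightarrow> real" and a assume "f \<in> {h. continuous_on (X \<times> Y) h}" and a: "(0::real) < a"
  then have f: "continuous_on (X \<times> Y) f" by auto
  have "majorant (\<lambda>z. a * f z) / a \<le> majorant f"
  proof (rule majorant_greatest[OF f])
    fix \<phi> \<psi> t assume 2: "continuous_on X \<phi>" "continuous_on Y \<psi>" "0 \<le> t"
      "\<And>x y. x \<in> X \<Longrightarrow> y \<in> Y \<Longrightarrow> f (x, y) \<le> \<phi> x + \<psi> y - \<psi> (shift_map y) + t * c (x, y)"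
    have "majorant (\<lambda>z. a * f z) \<le> (\<integral>x. a * \<phi> x \<partial>\<mu>) + (a * t) * dual_value"
    proof (rule majorant_le[where \<psi> = "\<lambda>y. a * \<psi> y"])
      show "a * f (x, y) \<le> a * \<phi> x + a * \<psi> y - a * \<psi> (shift_map y) + a * t * c (x, y)"
        if "x \<in> X" "y \<in> Y" for x y
        using mult_left_mono[OF 2(4)[OF that], of a] a by (simp add: algebra_simps)
    qed (use a 2(3) in \<open>auto intro!: continuous_intros f 2(1,2)\<close>)
    then show "majorant (\<lambda>z. a * f z) / a \<le> (\<integral>x. \<phi> x \<partial>\<mu>) + t * dual_value"
      using a by (simp add: field_simps)
  qed
  then show "majorant (\<lambda>z. a * f z) \<le> a * majorant f" using a by (simp add: field_simps)
next
  have "majorant (\<lambda>z. 0) \<le> 0"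
    using majorant_le[of "\<lambda>z. 0" "\<lambda>x. 0" "\<lambda>y. 0" 0] by simp
  moreover have "0 \<le> majorant (\<lambda>z. 0)"
    unfolding majorant_def
    by (rule cInf_greatest[OF majorant_values_nonempty majorant_values_lower]) auto
  ultimately show "majorant (\<lambda>z. 0) = 0" by simp
qed

theorem optimal_plan:
  obtains \<pi> where "\<pi> \<in> plans X d \<mu>" "(\<integral>z. c z \<partial>\<pi>) = dual_value"
proof -
  let ?C = "{h. continuous_on (X \<times> Y) h}"
  obtain L where lin: "linear_functional_on ?C L" and le: "\<And>h. h \<in> ?C \<Longrightarrow> L h \<le> majorant h"
    by (rule hahn_banach_dominated[OF function_subspace_continuous_on sublinear_majorant], rule that)
  have neg: "L (\<lambda>z. - h z) = - L h" if "continuous_on (X \<times> Y) h" for h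
  proof -
    have "L (\<lambda>z. - 1 * h z) = - 1 * L h"
      using that by (intro linear_functional_onD(2)[OF lin]) auto
    then show ?thesis by simp
  qed
  have L_le: "L h \<le> (\<integral>x. \<phi> x \<partial>\<mu>) + t * dual_value"
    if "continuous_on (X \<times> Y) h" "continuous_on X \<phi>" "continuous_on Y \<psi>" "0 \<le> t"
      "\<And>x y. x \<in> X \<Longrightarrow> y \<in> Y \<Longrightarrow> h (x, y) \<le> \<phi> x + \<psi> y - \<psi> (shift_map y) + t * c (x, y)"
    for h \<phi> \<psi> t
    using le[of h] majorant_le[OF that] that(1) by simp
  have marg: "L (\<lambda>z. f (fst z)) = (\<integral>x. f x \<partial>\<mu>)" if f: "continuous_on X f" for f
  proof -
    have "L (\<lambda>z. f (fst z)) \<le> (\<integral>x. f x \<partial>\<mu>) + 0 * dual_value"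
      by (rule L_le[of _ _ "\<lambda>y. 0"]) (auto intro: f continuous_on_fst_XY)
    moreover have "L (\<lambda>z. - f (fst z)) \<le> (\<integral>x. - f x \<partial>\<mu>) + 0 * dual_value"
      by (rule L_le[of _ _ "\<lambda>y. 0"]) (auto intro!: continuous_intros f continuous_on_fst_XY)
    ultimately show ?thesis
      using neg[OF continuous_on_fst_XY[OF f]] by simp
  qed
  have inv: "L (\<lambda>z. g (snd z)) = L (\<lambda>z. g (shift_map (snd z)))" if g: "continuous_on Y g" for g
  proof -
    note c1 = continuous_on_snd_XY[OF g]
      and c2 = continuous_on_snd_XY[OF continuous_on_compose_shift_map[OF g]]
    let ?h = "\<lambda>z. g (snd z) + - g (shift_map (snd z))"
    have h: "continuous_on (X \<times> Y) ?h"
      by (intro continuous_intros c1 c2)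
    have "L ?h \<le> (\<integral>x. 0 \<partial>\<mu>) + 0 * dual_value"
      by (rule L_le[of _ _ g, OF h]) (auto intro: g)
    moreover have "L (\<lambda>z. - ?h z) \<le> (\<integral>x. 0 \<partial>\<mu>) + 0 * dual_value"
      by (rule L_le[of _ _ "\<lambda>y. - g y", OF continuous_on_minus[OF h]])
        (auto intro: continuous_on_minus g)
    ultimately have "L ?h = 0" using neg[OF h] by simp
    moreover have "L ?h = L (\<lambda>z. g (snd z)) + L (\<lambda>z. - g (shift_map (snd z)))"
      using c1 continuous_on_minus[OF c2] by (intro linear_functional_onD(1)[OF lin]) auto
    ultimately show ?thesis using neg[OF c2] by simp
  qed
  have pos: "0 \<le> L h" if "continuous_on (X \<times> Y) h" "\<And>z. z \<in> X \<times> Y \<Longrightarrow> 0 \<le> h z" for h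
  proof -
    have "L (\<lambda>z. - h z) \<le> (\<integral>x. 0 \<partial>\<mu>) + 0 * dual_value"
      using that by (intro L_le[of _ _ "\<lambda>y. 0"]) (auto intro!: continuous_intros)
    then show ?thesis using neg[OF that(1)] by simp
  qed
  have "positive_functional (X \<times> Y) L"
  proof
    show "\<exists>g. continuous_on (X \<times> Y) g \<and> (\<forall>z\<in>X \<times> Y. 0 \<le> (g z :: real))
        \<and> (X \<times> Y) \<inter> U = {z \<in> X \<times> Y. 0 < g z}" if "open U" for U
      \<comment> \<open>Only the topology matters here, and every ratio in \<open>(0, 1)\<close>
        induces it; \<open>1/2\<close> is a witness.\<close>
      by (rule open_cozero_of_metric[OF mtopology_of_sum_shift_metric[of "1/2"] that]) auto
    show "L (\<lambda>z. 1) = 1"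
      using marg[of "\<lambda>x. 1"] by (simp add: mu.prob_space)
  qed (use compact_XY lin pos in auto)
  from positive_functional.riesz_representation[OF this]
  obtain \<pi> where \<pi>: "\<pi> \<in> borel_probs (X \<times> Y)"
    and int: "\<And>h. continuous_on (X \<times> Y) h \<Longrightarrow> (\<integral>z. h z \<partial>\<pi>) = L h"
    by metis
  have plan: "\<pi> \<in> plans X d \<mu>"
    unfolding plans_def
  proof (intro CollectI conjI allI impI \<pi>)
    show "(\<integral>z. f (fst z) \<partial>\<pi>) = (\<integral>x. f x \<partial>\<mu>)" if "continuous_on X f"
      for f :: "'a \<Rightarrow> real"
      unfolding int[OF continuous_on_fst_XY[OF that]] by (rule marg[OF that])
    show "(\<integral>z. g (snd z) \<partial>\<pi>) = (\<integral>z. g (shift_map (snd z)) \<partial>\<pi>)" if "continuous_on Y g"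
      for g :: "(nat \<Rightarrow> nat) \<Rightarrow> real"
      unfolding int[OF continuous_on_snd_XY[OF that]]
        int[OF continuous_on_snd_XY[OF continuous_on_compose_shift_map[OF that]]]
      by (rule inv[OF that])
  qed
  \<comment> \<open>Only this inequality comes from the extension; the reverse one is weak duality
    for the plan just found.\<close>
  have "L c \<le> (\<integral>x. 0 \<partial>\<mu>) + 1 * dual_value"
    by (rule L_le[of _ _ "\<lambda>y. 0"]) (auto intro: cont_c)
  then have "(\<integral>z. c z \<partial>\<pi>) = dual_value"
    using weak_duality[OF plan] int[OF cont_c] by simp
  with plan show thesis using that by blast
qed

end

subsection \<open>Lipschitz maximizers\<close>

lemma funpow_shift_map: "(shift_map ^^ n) y = (\<lambda>k. y (k + n))"
  by (induction n) (simp_all add: shift_map_def)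

lemma funpow_shift_map_in_full_shift: "y \<in> full_shift d \<Longrightarrow> (shift_map ^^ n) y \<in> full_shift d"
  by (simp add: funpow_shift_map full_shift_def)

text \<open>Inverse branches of the shift contract: each common symbol prepended to both sequences
  contributes a factor \<open>l\<close>.\<close>

lemma seq_dist_prefix:
  assumes "\<And>k. k < n \<Longrightarrow> u k = v k"
  shows "seq_dist l u v = l ^ n * seq_dist l ((shift_map ^^ n) u) ((shift_map ^^ n) v)"
  using assms
proof (induction n arbitrary: u v)
  case (Suc n)
  have 0: "u 0 = v 0" using Suc.prems by simp
  have "seq_dist l u v = l * seq_dist l (shift_map u) (shift_map v)"
  proof (cases "u = v")
    case False
    then obtain k where k: "u k \<noteq> v k" by blast
    have "(LEAST k. u k \<noteq> v k) = Suc (LEAST k. shift_map u k \<noteq> shift_map v k)"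
      unfolding shift_map_def by (rule Least_Suc[of "\<lambda>k. u k \<noteq> v k", OF k]) (simp add: 0)
    moreover have "shift_map u \<noteq> shift_map v"
      using k 0 unfolding shift_map_def by (metis not0_implies_Suc)
    ultimately show ?thesis using False by (simp add: seq_dist_def)
  qed (simp add: seq_dist_def)
  moreover have "seq_dist l (shift_map u) (shift_map v)
      = l ^ n * seq_dist l ((shift_map ^^ n) (shift_map u)) ((shift_map ^^ n) (shift_map v))"
    using Suc.prems by (intro Suc.IH) (simp add: shift_map_def)
  ultimately show ?case by (simp add: funpow_swap1)
qed simp

text \<open>Sequential compactness of \<open>[-B, B] ^ nat\<close>, applied to the values on a dense sequence,
  replaces the diagonal argument of the Arzela-Ascoli theorem.\<close>

lemma equilipschitz_subsequence:
  fixes X :: "'a::metric_space set" and F :: "nat \<Rightarrow> 'a \<Rightarrow> real"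
  assumes X: "compact X" and L: "0 \<le> L"
    and bound: "\<And>n x. x \<in> X \<Longrightarrow> \<bar>F n x\<bar> \<le> B"
    and lip: "\<And>n x x'. x \<in> X \<Longrightarrow> x' \<in> X \<Longrightarrow> \<bar>F n x - F n x'\<bar> \<le> L * dist x x'"
  obtains r :: "nat \<Rightarrow> nat" and \<phi> where "strict_mono r" "\<And>x. x \<in> X \<Longrightarrow> (\<lambda>n. F (r n) x) \<longlonglongrightarrow> \<phi> x"
proof (cases "X = {}")
  case True
  then show thesis using that[of id] by (simp add: strict_mono_id)
next
  case False
  have "\<exists>k. finite k \<and> k \<subseteq> X \<and> X \<subseteq> (\<Union>x\<in>k. ball x (1 / real (Suc m)))" for m
    using seq_compact_imp_totally_bounded[OF compact_imp_seq_compact[OF X], rule_format,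
        of "1 / real (Suc m)"] by simp
  then obtain k where k: "\<And>m. finite (k m)" "\<And>m. k m \<subseteq> X"
    "\<And>m. X \<subseteq> (\<Union>x\<in>k m. ball x (1 / real (Suc m)))"
    by metis
  define C where "C = (\<Union>m. k m)"
  have "countable C" unfolding C_def by (simp add: countable_finite[OF k(1)])
  moreover have "C \<noteq> {}" using k(3)[of 0] False by (auto simp: C_def)
  ultimately have C: "range (from_nat_into C) = C" by (rule range_from_nat_into[rotated])
  define s where "s = from_nat_into C"
  have s: "s i \<in> X" for i using C k(2) unfolding s_def C_def by blast
  have "compact (\<Pi>\<^sub>E i\<in>(UNIV::nat set). {- B..B})"
  proof -
    have "compactin (product_topology (\<lambda>i::nat. euclidean) UNIV) (\<Pi>\<^sub>E i\<in>UNIV. {- B..B})"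
      by (simp add: compactin_PiE)
    then show ?thesis by (simp add: euclidean_product_topology)
  qed
  moreover have "(\<lambda>i. F n (s i)) \<in> (\<Pi>\<^sub>E i\<in>UNIV. {- B..B})" for n
    using bound[OF s] by (auto simp: abs_le_iff minus_le_iff)
  ultimately obtain g and r :: "nat \<Rightarrow> nat" where r: "strict_mono r"
    and g: "((\<lambda>n i. F n (s i)) \<circ> r) \<longlonglongrightarrow> g"
    using seq_compactE[OF compact_imp_seq_compact] by metis
  have conv_s: "(\<lambda>n. F (r n) (s i)) \<longlonglongrightarrow> g i" for i
    using continuous_on_tendsto_compose[OF continuous_on_product_coordinates g, of i]
    by (simp add: comp_def)
  have "convergent (\<lambda>n. F (r n) x)" if x: "x \<in> X" for x
  proof (rule Cauchy_convergent, rule metric_CauchyI)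
    fix e :: real assume e: "0 < e"
    \<comment> \<open>\<open>L + 1\<close> avoids division by zero when \<open>L = 0\<close>; the 3
      shares \<open>e\<close> among two comparisons with a net point \<open>y\<close> and the Cauchy
      estimate at \<open>y\<close>.\<close>
    then have "0 < e / (3 * (L + 1))" using L by simp
    then obtain m where m: "1 / real (Suc m) < e / (3 * (L + 1))"
      using nat_approx_posE by blast
    obtain y where y: "y \<in> k m" "dist y x < 1 / real (Suc m)"
      using k(3)[of m] x by auto
    then have "y \<in> range s" using C by (auto simp: s_def C_def)
    then obtain i where i: "s i = y" by blast
    have "L * dist x y \<le> (L + 1) * dist x y" by (simp add: distrib_right)
    also have "\<dots> < (L + 1) * (e / (3 * (L + 1)))"
      using y m L by (intro mult_strict_left_mono) (auto simp: dist_commute)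
    also have "\<dots> = e / 3" using L by (simp add: field_simps)
    finally have close: "\<bar>F n x - F n y\<bar> < e / 3" for n
      using lip[OF x, of y n] s[of i] i by simp
    have "Cauchy (\<lambda>n. F (r n) y)"
      using conv_s[of i] i convergent_Cauchy convergentI by blast
    then obtain M where M: "\<And>p q. M \<le> p \<Longrightarrow> M \<le> q \<Longrightarrow> dist (F (r p) y) (F (r q) y) < e / 3"
      using e by (metis metric_CauchyD zero_less_divide_iff zero_less_numeral)
    have "dist (F (r p) x) (F (r q) x) < e" if "M \<le> p" "M \<le> q" for p q
      using M[OF that] close[of "r p"] close[of "r q"] unfolding dist_real_def by linarith
    then show "\<exists>M. \<forall>p\<ge>M. \<forall>q\<ge>M. dist (F (r p) x) (F (r q) x) < e" by blast
  qed
  then have "(\<lambda>n. F (r n) x) \<longlonglongrightarrow> lim (\<lambda>n. F (r n) x)" if "x \<in> X" for x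
    using that by (simp add: convergent_LIMSEQ_iff)
  with r show thesis by (rule that)
qed

locale lipschitz_shift_transport = shift_transport +
  fixes l L :: real
  assumes l: "0 < l" "l < 1" and L: "0 \<le> L"
    and lip_c: "\<And>x x' y y'. x \<in> X \<Longrightarrow> x' \<in> X \<Longrightarrow> y \<in> full_shift d \<Longrightarrow> y' \<in> full_shift d \<Longrightarrow>
      \<bar>c (x, y) - c (x', y')\<bar> \<le> L * (dist x x' + seq_dist l y y')"
begin

text \<open>A Birkhoff sum of \<open>\<phi> - c\<close> along the orbit of \<open>z\<close>, with
  the point of \<open>X\<close> chosen afresh at every step, since admissibility must hold against
  all of \<open>X\<close>.\<close>

definition surplus :: "('a \<Rightarrow> real) \<Rightarrow> (nat \<Rightarrow> 'a) \<Rightarrow> nat \<Rightarrow> (nat \<Rightarrow> nat) \<Rightarrow> real" where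
  "surplus \<phi> \<xi> n z = (\<Sum>i<n. \<phi> (\<xi> i) - c (\<xi> i, (shift_map ^^ i) z))"

definition surplus_bound :: "real \<Rightarrow> ('a \<Rightarrow> real) \<Rightarrow> bool" where
  "surplus_bound D \<phi> \<longleftrightarrow> (\<forall>n \<xi> z. range \<xi> \<subseteq> X \<longrightarrow> z \<in> Y \<longrightarrow> surplus \<phi> \<xi> n z \<le> D)"

text \<open>The sum telescopes to at most \<open>\<psi>\<close> at the end of the orbit minus
  \<open>\<psi>\<close> at its start, whatever the points \<open>\<xi> i\<close>.\<close>

lemma surplus_bound_of_admissible:
  assumes adm: "\<And>x y. x \<in> X \<Longrightarrow> y \<in> Y \<Longrightarrow> \<phi> x + \<psi> y - \<psi> (shift_map y) \<le> c (x, y)"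
    and osc: "\<And>y y'. y \<in> Y \<Longrightarrow> y' \<in> Y \<Longrightarrow> \<psi> y - \<psi> y' \<le> D"
  shows "surplus_bound D \<phi>"
  unfolding surplus_bound_def
proof (intro allI impI)
  fix n z and \<xi> :: "nat \<Rightarrow> 'a"
  assume \<xi>: "range \<xi> \<subseteq> X" and z: "z \<in> Y"
  have "surplus \<phi> \<xi> n z \<le> \<psi> ((shift_map ^^ n) z) - \<psi> z"
  proof (induction n)
    case (Suc n)
    have "\<phi> (\<xi> n) + \<psi> ((shift_map ^^ n) z) - \<psi> ((shift_map ^^ Suc n) z) \<le> c (\<xi> n, (shift_map ^^ n) z)"
      using adm[of "\<xi> n" "(shift_map ^^ n) z"] \<xi> funpow_shift_map_in_full_shift[OF z] by auto
    with Suc show ?case by (simp add: surplus_def)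
  qed (simp add: surplus_def)
  also have "\<dots> \<le> D" by (intro osc funpow_shift_map_in_full_shift z)
  finally show "surplus \<phi> \<xi> n z \<le> D" .
qed

text \<open>The potential is a value function over backward orbits, as for the Mane potential in ergodic
  optimization. Inverse branches of the shift contract, so its Lipschitz constant does not depend on
  \<open>\<phi>\<close>.\<close>

definition surpluses :: "('a \<Rightarrow> real) \<Rightarrow> (nat \<Rightarrow> nat) \<Rightarrow> real set" where
  "surpluses \<phi> y = {surplus \<phi> \<xi> n z | \<xi> n z. range \<xi> \<subseteq> X \<and> z \<in> Y \<and> (shift_map ^^ n) z = y}"

definition potential :: "('a \<Rightarrow> real) \<Rightarrow> (nat \<Rightarrow> nat) \<Rightarrow> real" where
  "potential \<phi> y = Sup (surpluses \<phi> y)"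

text \<open>\<open>L\<close> times a geometric series: a Lipschitz constant for every potential, and
  a bound for its oscillation because \<open>seq_dist l\<close> is at most 1.\<close>

abbreviation "osc_bound \<equiv> L / (1 - l)"

lemma surpluses_nonempty:
  assumes "y \<in> Y"
  shows "surpluses \<phi> y \<noteq> {}"
proof -
  obtain x where "x \<in> X" using X_nonempty by blast
  then have "surplus \<phi> (\<lambda>_. x) 0 y \<in> surpluses \<phi> y"
    unfolding surpluses_def using assms by (intro CollectI exI[of _ "\<lambda>_. x"] exI[of _ 0] exI[of _ y]) auto
  then show ?thesis by blast
qed

lemma le_potential:
  assumes "surplus_bound D \<phi>" "v \<in> surpluses \<phi> y"
  shows "v \<le> potential \<phi> y"
proof -
  have "bdd_above (surpluses \<phi> y)"
    using assms(1) by (intro bdd_aboveI[of _ D]) (auto simp: surpluses_def surplus_bound_def)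
  then show ?thesis using assms(2) by (simp add: potential_def cSup_upper)
qed

lemma potential_le:
  assumes "y \<in> Y" "\<And>v. v \<in> surpluses \<phi> y \<Longrightarrow> v \<le> a"
  shows "potential \<phi> y \<le> a"
  unfolding potential_def using assms by (intro cSup_least surpluses_nonempty)

text \<open>An orbit segment ending at \<open>y\<close> extends by one step to one ending at
  \<open>shift_map y\<close>; placing \<open>x\<close> at the new index \<open>n\<close> changes the
  surplus by \<open>\<phi> x - c (x, y)\<close>.\<close>

lemma potential_admissible:
  assumes \<phi>: "surplus_bound D \<phi>" and x: "x \<in> X" and y: "y \<in> Y"
  shows "\<phi> x + potential \<phi> y - potential \<phi> (shift_map y) \<le> c (x, y)"
proof -
  have "potential \<phi> y \<le> potential \<phi> (shift_map y) + c (x, y) - \<phi> x"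
  proof (rule potential_le[OF y])
    fix v assume "v \<in> surpluses \<phi> y"
    then obtain \<xi> n z where v: "v = surplus \<phi> \<xi> n z" "range \<xi> \<subseteq> X" "z \<in> Y" "(shift_map ^^ n) z = y"
      unfolding surpluses_def by blast
    have "surplus \<phi> (\<xi>(n := x)) (Suc n) z = v + \<phi> x - c (x, y)"
      using v(4) by (simp add: surplus_def v(1))
    moreover have "surplus \<phi> (\<xi>(n := x)) (Suc n) z \<in> surpluses \<phi> (shift_map y)"
      unfolding surpluses_def using v x
      by (intro CollectI exI[of _ "\<xi>(n := x)"] exI[of _ "Suc n"] exI[of _ z]) auto
    ultimately show "v \<le> potential \<phi> (shift_map y) + c (x, y) - \<phi> x"
      using le_potential[OF \<phi>] by fastforce
  qed
  then show ?thesis by simp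
qed

lemma sum_geometric_le: "(\<Sum>i<n. l ^ (n - i)) \<le> 1 / (1 - l)"
proof -
  have "(\<Sum>i<n. l ^ (n - i)) \<le> (\<Sum>i<n. l ^ (n - Suc i))"
    using l by (intro sum_mono power_decreasing) auto
  also have "\<dots> = (\<Sum>i<n. l ^ i)" by (rule sum.nat_diff_reindex)
  also have "\<dots> = (1 - l ^ n) / (1 - l)" using l by (simp add: sum_gp_strict)
  also have "\<dots> \<le> 1 / (1 - l)" using l by (intro divide_right_mono) auto
  finally show ?thesis .
qed

text \<open>Given a segment ending at \<open>y\<close>, keep its points \<open>\<xi>\<close> and its
  first \<open>n\<close> symbols and replace the tail by \<open>y'\<close>. The
  \<open>\<phi>\<close> terms cancel, so the constant comes from \<open>c\<close> and
  \<open>l\<close> only.\<close>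

lemma potential_lipschitz:
  assumes \<phi>: "surplus_bound D \<phi>" and y: "y \<in> Y" "y' \<in> Y"
  shows "potential \<phi> y \<le> potential \<phi> y' + osc_bound * seq_dist l y y'"
proof (rule potential_le[OF y(1)])
  fix v assume "v \<in> surpluses \<phi> y"
  then obtain \<xi> n z where v: "v = surplus \<phi> \<xi> n z" "range \<xi> \<subseteq> X" "z \<in> Y" "(shift_map ^^ n) z = y"
    unfolding surpluses_def by blast
  define z' where "z' k = (if k < n then z k else y' (k - n))" for k
  have z': "z' \<in> Y" using v(3) y(2) by (auto simp: z'_def full_shift_def)
  have z'_n: "(shift_map ^^ n) z' = y'" by (simp add: funpow_shift_map z'_def)
  have dist_nonneg: "0 \<le> seq_dist l y y'" using l by (simp add: seq_dist_def)
  \<comment> \<open>At time \<open>i\<close> both orbits still share \<open>n - i\<close> symbols,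
    followed by \<open>y'\<close> and \<open>y\<close>.\<close>
  have dist: "seq_dist l ((shift_map ^^ i) z') ((shift_map ^^ i) z) = l ^ (n - i) * seq_dist l y y'"
    if "i < n" for i
  proof -
    have "seq_dist l ((shift_map ^^ i) z) ((shift_map ^^ i) z')
        = l ^ (n - i) * seq_dist l ((shift_map ^^ (n - i)) ((shift_map ^^ i) z))
            ((shift_map ^^ (n - i)) ((shift_map ^^ i) z'))"
      by (rule seq_dist_prefix) (auto simp: funpow_shift_map z'_def)
    moreover have "(shift_map ^^ (n - i)) ((shift_map ^^ i) u) = (shift_map ^^ n) u" for u :: "nat \<Rightarrow> nat"
      using that by (simp add: funpow_shift_map)
    moreover have "seq_dist l ((shift_map ^^ i) z) ((shift_map ^^ i) z')
        = seq_dist l ((shift_map ^^ i) z') ((shift_map ^^ i) z)"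
      using Metric_space.commute[OF Metric_space_seq_dist[OF l]] .
    ultimately show ?thesis using v(4) z'_n by simp
  qed
  have "surplus \<phi> \<xi> n z - surplus \<phi> \<xi> n z'
      = (\<Sum>i<n. c (\<xi> i, (shift_map ^^ i) z') - c (\<xi> i, (shift_map ^^ i) z))"
    by (simp add: surplus_def sum_subtractf[symmetric])
  also have "\<dots> \<le> (\<Sum>i<n. L * (l ^ (n - i) * seq_dist l y y'))"
  proof (rule sum_mono)
    fix i assume "i \<in> {..<n}"
    moreover have "\<xi> i \<in> X" using v(2) by auto
    ultimately show "c (\<xi> i, (shift_map ^^ i) z') - c (\<xi> i, (shift_map ^^ i) z)
        \<le> L * (l ^ (n - i) * seq_dist l y y')"
      using lip_c[of "\<xi> i" "\<xi> i" "(shift_map ^^ i) z'" "(shift_map ^^ i) z"] dist[of i]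
        funpow_shift_map_in_full_shift[OF v(3)] funpow_shift_map_in_full_shift[OF z'] by auto
  qed
  also have "\<dots> = L * seq_dist l y y' * (\<Sum>i<n. l ^ (n - i))"
    by (simp add: sum_distrib_left mult_ac)
  also have "\<dots> \<le> L * seq_dist l y y' * (1 / (1 - l))"
    using L dist_nonneg by (intro mult_left_mono sum_geometric_le) auto
  finally have "v \<le> surplus \<phi> \<xi> n z' + osc_bound * seq_dist l y y'" by (simp add: v(1))
  moreover have "surplus \<phi> \<xi> n z' \<in> surpluses \<phi> y'"
    unfolding surpluses_def using v(2) z' z'_n by blast
  ultimately show "v \<le> potential \<phi> y' + osc_bound * seq_dist l y y'"
    using le_potential[OF \<phi>] by fastforce
qed

lemma seq_dist_le_one: "seq_dist l y y' \<le> 1"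
  using l by (simp add: seq_dist_def power_le_one)

lemma potential_osc:
  assumes "surplus_bound D \<phi>" "y \<in> Y" "y' \<in> Y"
  shows "potential \<phi> y - potential \<phi> y' \<le> osc_bound"
proof -
  have "osc_bound * seq_dist l y y' \<le> osc_bound * 1"
    using l L by (intro mult_left_mono seq_dist_le_one) auto
  then show ?thesis using potential_lipschitz[OF assms] by simp
qed

lemma Lipschitz_potential:
  assumes "surplus_bound D \<phi>"
  shows "Lipschitz_continuous_map (shift_metric l d) euclidean_metric (potential \<phi>)"
  unfolding Lipschitz_continuous_map_def
proof (intro conjI exI[of _ osc_bound] ballI)
  fix y y' assume "y \<in> mspace (shift_metric l d)" "y' \<in> mspace (shift_metric l d)"
  then have y: "y \<in> Y" "y' \<in> Y" by (simp_all add: l)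
  have "seq_dist l y y' = seq_dist l y' y"
    using Metric_space.commute[OF Metric_space_seq_dist[OF l]] .
  then show "mdist euclidean_metric (potential \<phi> y) (potential \<phi> y')
      \<le> osc_bound * mdist (shift_metric l d) y y'"
    using potential_lipschitz[OF assms y] potential_lipschitz[OF assms y(2,1)]
    by (simp add: l dist_real_def abs_le_iff)
qed auto

lemma continuous_on_potential:
  assumes "surplus_bound D \<phi>"
  shows "continuous_on Y (potential \<phi>)"
  using Lipschitz_continuous_imp_continuous_map[OF Lipschitz_potential[OF assms]]
  by (simp add: mtopology_of_shift_metric[OF l] continuous_map_iff_continuous)

lemma admissible_potential:
  assumes "surplus_bound D \<phi>" "continuous_on X \<phi>"
  shows "(\<phi>, potential \<phi>) \<in> admissible_pairs X d c"
  using assms potential_admissible[OF assms(1)] continuous_on_potential[OF assms(1)]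
  by (simp add: admissible_pairs_iff)

section \<open>Uniform bounds and passage to the limit\<close>

lemma continuous_on_of_lipschitz:
  assumes "\<And>x x'. x \<in> X \<Longrightarrow> x' \<in> X \<Longrightarrow> \<bar>\<phi> x - \<phi> x'\<bar> \<le> L * dist x x'"
  shows "continuous_on X \<phi>"
  using assms L by (intro lipschitz_on_continuous_on[of L] lipschitz_onI) (auto simp: dist_real_def)

text \<open>Combines two bounds for an improved function: at most \<open>c (x, fixed)\<close>, as
  the coboundary vanishes at \<open>fixed\<close>, and at least \<open>- osc_bound\<close>, as
  \<open>c\<close> is nonnegative.\<close>

definition slice_bound :: real where
  "slice_bound = (SUP x\<in>X. c (x, fixed)) + osc_bound"

text \<open>Pass to the potential of \<open>\<phi>\<close>, whose oscillation is at most \<open>osc_bound\<close>, then to the largest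
  \<open>\<phi>'\<close> admissible with it.\<close>

lemma improve:
  assumes adm: "(\<phi>, \<psi>) \<in> admissible_pairs X d c"
  obtains \<phi>' where "surplus_bound osc_bound \<phi>'"
    and "\<And>x x'. x \<in> X \<Longrightarrow> x' \<in> X \<Longrightarrow> \<bar>\<phi>' x - \<phi>' x'\<bar> \<le> L * dist x x'"
    and "\<And>x. x \<in> X \<Longrightarrow> \<bar>\<phi>' x\<bar> \<le> slice_bound"
    and "(\<integral>x. \<phi> x \<partial>\<mu>) \<le> (\<integral>x. \<phi>' x \<partial>\<mu>)"
proof -
  have \<phi>: "continuous_on X \<phi>" and \<psi>: "continuous_on Y \<psi>"
    and le: "\<And>x y. x \<in> X \<Longrightarrow> y \<in> Y \<Longrightarrow> \<phi> x + \<psi> y - \<psi> (shift_map y) \<le> c (x, y)"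
    using adm by (auto simp: admissible_pairs_iff)
  obtain B where B: "\<forall>y\<in>Y. norm (\<psi> y) \<le> B"
    using compact_imp_bounded[OF compact_continuous_image[OF \<psi> compact_full_shift]]
    by (auto simp: bounded_iff)
  have "\<psi> y - \<psi> y' \<le> 2 * B" if "y \<in> Y" "y' \<in> Y" for y y'
    using bspec[OF B that(1)] bspec[OF B that(2)] unfolding real_norm_def abs_le_iff by linarith
  \<comment> \<open>This bound still depends on \<open>\<psi>\<close>; it only ensures that the
    suprema defining \<open>potential \<phi>\<close> are finite.\<close>
  then have "surplus_bound (2 * B) \<phi>"
    by (intro surplus_bound_of_admissible[of _ \<psi>] le)
  note pot_le = potential_admissible[OF this] and pot_osc = potential_osc[OF this]
  define p where "p = potential \<phi>"
  \<comment> \<open>The c-transform of the coboundary of \<open>p\<close>: an infimum of functions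
    of \<open>x\<close> that are all \<open>L\<close>-Lipschitz.\<close>
  define \<phi>' where "\<phi>' x = (INF y\<in>Y. c (x, y) - p y + p (shift_map y))" for x
  have low: "- osc_bound \<le> c (x, y) - p y + p (shift_map y)" if "x \<in> X" "y \<in> Y" for x y
    using c_nonneg[of "(x, y)"] pot_osc[of y "shift_map y"] that shift_map_in_full_shift[OF that(2)]
    by (simp add: p_def)
  have \<phi>'_le: "\<phi>' x \<le> c (x, y) - p y + p (shift_map y)" if "x \<in> X" "y \<in> Y" for x y
    unfolding \<phi>'_def using low[OF that(1)] that(2)
    by (intro cINF_lower bdd_belowI2[where m = "- osc_bound"]) auto
  have \<phi>'_ge: "a \<le> \<phi>' x" if "\<And>y. y \<in> Y \<Longrightarrow> a \<le> c (x, y) - p y + p (shift_map y)" for a x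
    unfolding \<phi>'_def using that fixed_in by (intro cINF_greatest) auto
  have lip1: "\<phi>' x \<le> \<phi>' x' + L * dist x x'" if "x \<in> X" "x' \<in> X" for x x'
  proof -
    have "\<phi>' x - L * dist x x' \<le> \<phi>' x'"
    proof (rule \<phi>'_ge)
      fix y assume y: "y \<in> Y"
      have "seq_dist l y y = 0" by (simp add: seq_dist_def)
      then show "\<phi>' x - L * dist x x' \<le> c (x', y) - p y + p (shift_map y)"
        using \<phi>'_le[OF that(1) y] lip_c[OF that y y] by (simp add: abs_le_iff)
    qed
    then show ?thesis by simp
  qed
  have lip: "\<bar>\<phi>' x - \<phi>' x'\<bar> \<le> L * dist x x'" if "x \<in> X" "x' \<in> X" for x x'
    using lip1[OF that] lip1[OF that(2,1)] by (simp add: abs_le_iff dist_commute)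
  have \<phi>'_cont: "continuous_on X \<phi>'" by (rule continuous_on_of_lipschitz[OF lip])
  have "surplus_bound osc_bound \<phi>'"
  proof (rule surplus_bound_of_admissible[of _ p])
    show "\<phi>' x + p y - p (shift_map y) \<le> c (x, y)" if "x \<in> X" "y \<in> Y" for x y
      using \<phi>'_le[OF that] by simp
    show "p y - p y' \<le> osc_bound" if "y \<in> Y" "y' \<in> Y" for y y'
      unfolding p_def by (rule pot_osc[OF that])
  qed
  moreover have "\<bar>\<phi>' x\<bar> \<le> slice_bound" if x: "x \<in> X" for x
  proof -
    have bdd: "bdd_above ((\<lambda>x. c (x, fixed)) ` X)"
      using compact_imp_bounded[OF compact_continuous_image[OF cont_c_slice[OF fixed_in] compact_X]]
      by (rule bounded_imp_bdd_above)
    have "c (x, fixed) \<le> (SUP x\<in>X. c (x, fixed))"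
      by (rule cSUP_upper[OF x bdd])
    moreover have "\<phi>' x \<le> c (x, fixed)"
      using \<phi>'_le[OF x fixed_in] by (simp add: shift_fixed)
    moreover have "- osc_bound \<le> \<phi>' x"
      using low[OF x] by (rule \<phi>'_ge)
    moreover have "0 \<le> c (x, fixed)" using c_nonneg x fixed_in by auto
    moreover have "0 \<le> osc_bound" using l L by simp
    ultimately show ?thesis unfolding slice_bound_def by linarith
  qed
  moreover have "(\<integral>x. \<phi> x \<partial>\<mu>) \<le> (\<integral>x. \<phi>' x \<partial>\<mu>)"
  proof (intro integral_mu_mono \<phi> \<phi>'_cont \<phi>'_ge)
    show "\<phi> x \<le> c (x, y) - p y + p (shift_map y)" if "x \<in> X" "y \<in> Y" for x y
      using pot_le[OF that] by (simp add: p_def)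
  qed
  ultimately show thesis using that lip by blast
qed

text \<open>After \<open>improve\<close> the bounds are the same along the whole maximizing
  sequence, so they pass to a pointwise limit; so do the integrals, dominated by the constant
  \<open>slice_bound\<close>.\<close>

theorem lipschitz_maximizer:
  obtains \<phi> \<psi> where "Lipschitz_continuous_map (submetric euclidean_metric X) euclidean_metric \<phi>"
    "Lipschitz_continuous_map (shift_metric l d) euclidean_metric \<psi>"
    "(\<phi>, \<psi>) \<in> admissible_pairs X d c" "(\<integral>x. \<phi> x \<partial>\<mu>) = dual_value"
proof -
  have "\<exists>\<phi>. surplus_bound osc_bound \<phi> \<and> (\<forall>x\<in>X. \<forall>x'\<in>X. \<bar>\<phi> x - \<phi> x'\<bar> \<le> L * dist x x')
      \<and> (\<forall>x\<in>X. \<bar>\<phi> x\<bar> \<le> slice_bound) \<and> dual_value - 1 / real (Suc n) \<le> (\<integral>x. \<phi> x \<partial>\<mu>)" for n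
  proof -
    have "dual_value - 1 / real (Suc n) < dual_value" by simp
    then obtain \<phi> \<psi> where 1: "(\<phi>, \<psi>) \<in> admissible_pairs X d c"
      "dual_value - 1 / real (Suc n) < (\<integral>x. \<phi> x \<partial>\<mu>)"
      by (rule dual_value_approx)
    obtain \<phi>' where "surplus_bound osc_bound \<phi>'"
      "\<And>x x'. x \<in> X \<Longrightarrow> x' \<in> X \<Longrightarrow> \<bar>\<phi>' x - \<phi>' x'\<bar> \<le> L * dist x x'"
      "\<And>x. x \<in> X \<Longrightarrow> \<bar>\<phi>' x\<bar> \<le> slice_bound" "(\<integral>x. \<phi> x \<partial>\<mu>) \<le> (\<integral>x. \<phi>' x \<partial>\<mu>)"
      by (rule improve[OF 1(1)], rule that)
    with 1(2) show ?thesis by (intro exI[of _ \<phi>']) auto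
  qed
  then obtain F where F_bound: "\<And>n. surplus_bound osc_bound (F n)"
    and F_lip: "\<And>n x x'. x \<in> X \<Longrightarrow> x' \<in> X \<Longrightarrow> \<bar>F n x - F n x'\<bar> \<le> L * dist x x'"
    and F_abs: "\<And>n x. x \<in> X \<Longrightarrow> \<bar>F n x\<bar> \<le> slice_bound"
    and F_int: "\<And>n. dual_value - 1 / real (Suc n) \<le> (\<integral>x. F n x \<partial>\<mu>)"
    by metis
  obtain r \<phi> where r: "strict_mono r" and lim: "\<And>x. x \<in> X \<Longrightarrow> (\<lambda>n. F (r n) x) \<longlonglongrightarrow> \<phi> x"
    by (rule equilipschitz_subsequence[of X L F slice_bound, OF compact_X L],
        erule F_abs, erule (1) F_lip, rule that)
  have lip: "\<bar>\<phi> x - \<phi> x'\<bar> \<le> L * dist x x'" if x: "x \<in> X" "x' \<in> X" for x x'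
  proof (rule LIMSEQ_le_const2)
    show "(\<lambda>n. \<bar>F (r n) x - F (r n) x'\<bar>) \<longlonglongrightarrow> \<bar>\<phi> x - \<phi> x'\<bar>"
      by (intro tendsto_intros lim x)
  qed (use F_lip[OF x] in auto)
  have cont: "continuous_on X \<phi>" by (rule continuous_on_of_lipschitz[OF lip])
  have sb: "surplus_bound osc_bound \<phi>"
    unfolding surplus_bound_def
  proof (intro allI impI)
    fix n z and \<xi> :: "nat \<Rightarrow> 'a"
  assume \<xi>: "range \<xi> \<subseteq> X" and z: "z \<in> Y"
    show "surplus \<phi> \<xi> n z \<le> osc_bound"
    proof (rule LIMSEQ_le_const2)
      show "(\<lambda>k. surplus (F (r k)) \<xi> n z) \<longlonglongrightarrow> surplus \<phi> \<xi> n z"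
        unfolding surplus_def using \<xi> by (intro tendsto_intros lim) auto
    qed (use F_bound \<xi> z in \<open>auto simp: surplus_bound_def\<close>)
  qed
  note adm = admissible_potential[OF sb cont]
  have conv: "(\<lambda>n. \<integral>x. F (r n) x \<partial>\<mu>) \<longlonglongrightarrow> (\<integral>x. \<phi> x \<partial>\<mu>)"
  proof (rule integral_dominated_convergence[where w = "\<lambda>x. slice_bound"])
    show "\<phi> \<in> borel_measurable \<mu>" "F (r n) \<in> borel_measurable \<mu>" for n
      by (intro borel_measurable_continuous_on_borel_probs[OF mu] cont continuous_on_of_lipschitz
          F_lip; assumption)+
  qed (use lim F_abs in \<open>auto simp: space_borel_probs[OF mu]\<close>)
  have "(\<lambda>n. dual_value - 1 / real (Suc (r n))) \<longlonglongrightarrow> dual_value - 0"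
    using LIMSEQ_subseq_LIMSEQ[OF LIMSEQ_inverse_real_of_nat r]
    by (intro tendsto_diff tendsto_const) (simp add: comp_def inverse_eq_divide)
  then have "dual_value - 0 \<le> (\<integral>x. \<phi> x \<partial>\<mu>)"
    by (rule LIMSEQ_le[OF _ conv]) (use F_int in auto)
  with integral_le_dual_value[OF adm] have "(\<integral>x. \<phi> x \<partial>\<mu>) = dual_value" by simp
  moreover have "Lipschitz_continuous_map (submetric euclidean_metric X) euclidean_metric \<phi>"
    unfolding Lipschitz_continuous_map_def using lip by (auto simp: dist_real_def)
  ultimately show thesis using that Lipschitz_potential[OF sb] adm by blast
qed

end

theorem theorem1:
  fixes X :: "'a::metric_space set"
    and d :: nat
    and l :: real
    and \<mu> :: "'a measure"
    and c :: "'a \<times> (nat \<Rightarrow> nat) \<Rightarrow> real"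
  assumes "compact X"
    and "1 \<le> d"
    and "0 < l" and "l < 1"
    and "\<mu> \<in> borel_probs X"
    and "continuous_on (X \<times> full_shift d) c"
    and "\<forall>z \<in> X \<times> full_shift d. 0 \<le> c z"
  shows "(INF \<pi> \<in> plans X d \<mu>. ereal (\<integral>z. c z \<partial>\<pi>))
           = (SUP (\<phi>, \<psi>) \<in> admissible_pairs X d c. ereal (\<integral>x. \<phi> x \<partial>\<mu>))
       \<and> (\<exists>\<pi> \<in> plans X d \<mu>.
            ereal (\<integral>z. c z \<partial>\<pi>) = (INF \<pi>' \<in> plans X d \<mu>. ereal (\<integral>z. c z \<partial>\<pi>')))
       \<and> (Lipschitz_continuous_map
             (sum_metric (submetric euclidean_metric X) (shift_metric l d)) euclidean_metric c
           \<longrightarrow> (\<exists>\<phi> \<psi>. Lipschitz_continuous_map (submetric euclidean_metric X) euclidean_metric \<phi>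
                 \<and> Lipschitz_continuous_map (shift_metric l d) euclidean_metric \<psi>
                 \<and> (\<phi>, \<psi>) \<in> admissible_pairs X d c
                 \<and> ereal (\<integral>x. \<phi> x \<partial>\<mu>)
                     = (SUP (\<phi>', \<psi>') \<in> admissible_pairs X d c. ereal (\<integral>x. \<phi>' x \<partial>\<mu>))))"
proof -
  interpret shift_transport X d \<mu> c
    by standard (use assms in auto)
  obtain \<pi> where \<pi>: "\<pi> \<in> plans X d \<mu>" "(\<integral>z. c z \<partial>\<pi>) = dual_value"
    by (rule optimal_plan)
  have INF: "(INF \<pi> \<in> plans X d \<mu>. ereal (\<integral>z. c z \<partial>\<pi>)) = ereal dual_value"
  proof (rule antisym)
    show "(INF \<pi> \<in> plans X d \<mu>. ereal (\<integral>z. c z \<partial>\<pi>)) \<le> ereal dual_value"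
      using INF_lower[OF \<pi>(1), of "\<lambda>\<pi>. ereal (\<integral>z. c z \<partial>\<pi>)"] \<pi>(2) by simp
  qed (auto intro!: INF_greatest weak_duality)
  have "\<exists>\<phi> \<psi>. Lipschitz_continuous_map (submetric euclidean_metric X) euclidean_metric \<phi>
      \<and> Lipschitz_continuous_map (shift_metric l d) euclidean_metric \<psi>
      \<and> (\<phi>, \<psi>) \<in> admissible_pairs X d c \<and> (\<integral>x. \<phi> x \<partial>\<mu>) = dual_value"
    if lip: "Lipschitz_continuous_map
      (sum_metric (submetric euclidean_metric X) (shift_metric l d)) euclidean_metric c"
  proof -
    obtain L where L: "0 < L" "\<And>z z'. z \<in> X \<times> Y \<Longrightarrow> z' \<in> X \<times> Y \<Longrightarrow>
        \<bar>c z - c z'\<bar> \<le> L * (dist (fst z) (fst z') + seq_dist l (snd z) (snd z'))"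
      using lip \<open>0 < l\<close> \<open>l < 1\<close> by (auto simp: Lipschitz_continuous_map_pos dist_real_def)
    interpret lipschitz_shift_transport X d \<mu> c l L
    proof
      show "\<bar>c (x, y) - c (x', y')\<bar> \<le> L * (dist x x' + seq_dist l y y')"
        if "x \<in> X" "x' \<in> X" "y \<in> Y" "y' \<in> Y" for x x' y y'
        using L(2)[of "(x, y)" "(x', y')"] that by simp
    qed (use assms L(1) in auto)
    show ?thesis using lipschitz_maximizer by metis
  qed
  then show ?thesis
    using \<pi> by (auto simp: INF SUP_ereal_dual_value)
qed

end
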